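(* Let $H$ be a Hilbert space and let $S\subset B(H)$ be an operator system. Then \[ \operatorname{span}\operatorname{Ab}(S)=\mathrm{Ex}(S)\cap\ker\theta \] for every minimal $S$-projection $\theta:B(H)\to B(H)$.
   Context: An operator system $S\subset B(H)$ is a self-adjoint subspace containing the identity. Put $A=\mathrm{C}^*(S)$, the $\mathrm{C}^*$-subalgebra of $B(H)$ generated by $S$. An $S$-map is a unital completely positive map $\phi:B(H)\to B(H)$ with $\phi|_S=\mathrm{id}$. An $S$-projection is an $S$-map $\theta$ with $\theta\circ\theta=\theta$. The set of $S$-projections is partially ordered by: $\psi\prec\theta$ if and only if $\psi\circ\theta=\theta\circ\psi=\psi$. A minimal $S$-projection is a minimal element for this order. The set of abnormalities of $S$ is $\operatorname{Ab}(S)=\{\phi(a)-a: a\in A,\ \phi\in E\}\subset B(H)$, where $E$ is the set of unital completely positive maps $\phi:A\to B(H)$ with $\phi(s)=s$ for all $s\in S$. The expanse of $S$ is $\mathrm{Ex}(S)=\operatorname{span}\{\phi(A)\}$, the linear span in $B(H)$ of the union of the sets $\phi(A)$ over all $S$-maps $\phi:B(H)\to B(H)$. All spans are linear spans (no closure). *)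

theory Defs
  imports "HOL-Analysis.Analysis"
begin

section \<open>Complex Hilbert spaces\<close>

class complex_vector = real_vector +
  fixes scaleC :: "complex \<Rightarrow> 'a \<Rightarrow> 'a"  (infixr \<open>*\<^sub>C\<close> 75)
  assumes scaleC_add_right: "c *\<^sub>C (x + y) = c *\<^sub>C x + c *\<^sub>C y"
    and scaleC_add_left: "(c + d) *\<^sub>C x = c *\<^sub>C x + d *\<^sub>C x"
    and scaleC_scaleC: "c *\<^sub>C d *\<^sub>C x = (c * d) *\<^sub>C x"
    and scaleC_one: "1 *\<^sub>C x = x"
    and scaleR_scaleC: "r *\<^sub>R x = complex_of_real r *\<^sub>C x"

global_interpretation complex_vector: vector_space "scaleC :: complex \<Rightarrow> 'a \<Rightarrow> 'a :: complex_vector"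
  defines csubspace = complex_vector.subspace
    and cspan = complex_vector.span
  by standard (simp_all add: scaleC_add_right scaleC_add_left scaleC_scaleC scaleC_one)

text \<open>The inner product is linear in its first argument.\<close>

class complex_hilbert_space = complex_vector + banach +
  fixes cinner :: "'a \<Rightarrow> 'a \<Rightarrow> complex"
  assumes cinner_add_left: "cinner (x + y) z = cinner x z + cinner y z"
    and cinner_scaleC_left: "cinner (c *\<^sub>C x) y = c * cinner x y"
    and cinner_commute: "cinner x y = cnj (cinner y x)"
    and cinner_self: "cinner x x = complex_of_real ((norm x)\<^sup>2)"


section \<open>The algebra of bounded operators\<close>

typedef (overloaded) 'h bop =
  "{T :: 'h::complex_hilbert_space \<Rightarrow> 'h. bounded_linear T \<and> (\<forall>c x. T (c *\<^sub>C x) = c *\<^sub>C T x)}"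
  morphisms op_apply Op
  by (rule exI[of _ "\<lambda>x. x"]) simp

setup_lifting type_definition_bop

lemma bounded_linear_op_apply: "bounded_linear (op_apply T)"
  using op_apply[of T] by simp

lemma op_apply_scaleC: "op_apply T (c *\<^sub>C x) = c *\<^sub>C op_apply T x"
  using op_apply[of T] by simp

lemma bop_eqI: "(\<And>x. op_apply S x = op_apply T x) \<Longrightarrow> S = T"
  by (simp add: op_apply_inject[symmetric] fun_eq_iff)

lemma norm_scaleC: "norm (c *\<^sub>C x) = cmod c * norm (x :: 'h::complex_hilbert_space)"
proof -
  have "cinner (c *\<^sub>C x) (c *\<^sub>C x) = c * cnj c * cinner x x"
    by (metis (no_types, lifting) cinner_commute cinner_scaleC_left complex_cnj_mult mult.assoc)
  then have "complex_of_real ((norm (c *\<^sub>C x))\<^sup>2) = complex_of_real ((cmod c * norm x)\<^sup>2)"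
    by (simp only: cinner_self complex_norm_square[symmetric] power_mult_distrib of_real_mult)
  then show ?thesis
    by (simp only: of_real_eq_iff power2_eq_iff_nonneg norm_ge_zero mult_nonneg_nonneg)
qed

lemma bounded_linear_scaleC: "bounded_linear (\<lambda>x :: 'h::complex_hilbert_space. c *\<^sub>C x)"
proof (rule bounded_linear_intro)
  show "c *\<^sub>C (x + y) = c *\<^sub>C x + c *\<^sub>C y" for x y :: 'h
    by (rule scaleC_add_right)
  show "c *\<^sub>C r *\<^sub>R x = r *\<^sub>R c *\<^sub>C x" for r and x :: 'h
    by (simp add: scaleR_scaleC scaleC_scaleC mult.commute)
  show "norm (c *\<^sub>C x) \<le> norm x * cmod c" for x :: 'h
    by (simp add: norm_scaleC mult.commute)
qed

text \<open>The norm is the operator norm.\<close>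

instantiation bop :: (complex_hilbert_space) "{real_normed_vector, complex_vector}"
begin

lift_definition norm_bop :: "'a bop \<Rightarrow> real" is onorm .

lift_definition zero_bop :: "'a bop" is "\<lambda>x. 0"
  by (simp add: complex_vector.scale_zero_right)

lift_definition plus_bop :: "'a bop \<Rightarrow> 'a bop \<Rightarrow> 'a bop" is "\<lambda>S T x. S x + T x"
  by (simp add: bounded_linear_add scaleC_add_right)

lift_definition uminus_bop :: "'a bop \<Rightarrow> 'a bop" is "\<lambda>T x. - T x"
  by (simp add: bounded_linear_minus complex_vector.scale_minus_right)

lift_definition minus_bop :: "'a bop \<Rightarrow> 'a bop \<Rightarrow> 'a bop" is "\<lambda>S T x. S x - T x"
  by (simp add: bounded_linear_sub complex_vector.scale_right_diff_distrib)

lift_definition scaleC_bop :: "complex \<Rightarrow> 'a bop \<Rightarrow> 'a bop" is "\<lambda>c T x. c *\<^sub>C T x"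
  by (simp add: bounded_linear_compose[OF bounded_linear_scaleC] scaleC_scaleC mult.commute)

lift_definition scaleR_bop :: "real \<Rightarrow> 'a bop \<Rightarrow> 'a bop" is "\<lambda>r T x. r *\<^sub>R T x"
  by (simp add: bounded_linear_compose[OF bounded_linear_scaleC] scaleR_scaleC scaleC_scaleC mult.commute)

definition dist_bop :: "'a bop \<Rightarrow> 'a bop \<Rightarrow> real"
  where "dist_bop S T = norm (S - T)"

definition sgn_bop :: "'a bop \<Rightarrow> 'a bop"
  where "sgn_bop T = inverse (norm T) *\<^sub>R T"

definition uniformity_bop :: "('a bop \<times> 'a bop) filter"
  where "uniformity_bop = (INF e\<in>{0 <..}. principal {(S, T). dist S T < e})"

definition open_bop :: "'a bop set \<Rightarrow> bool"
  where "open_bop U = (\<forall>S\<in>U. \<forall>\<^sub>F (S', T) in uniformity. S' = S \<longrightarrow> T \<in> U)"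

instance
proof
  fix S T R :: "'a bop" and r s :: real and c d :: complex
  show "S + T + R = S + (T + R)" by transfer (simp add: algebra_simps)
  show "S + T = T + S" by transfer (simp add: algebra_simps)
  show "0 + S = S" by transfer simp
  show "- S + S = 0" by transfer simp
  show "S - T = S + - T" by transfer simp
  show "r *\<^sub>R (S + T) = r *\<^sub>R S + r *\<^sub>R T" by transfer (simp add: algebra_simps)
  show "(r + s) *\<^sub>R S = r *\<^sub>R S + s *\<^sub>R S" by transfer (simp add: algebra_simps)
  show "r *\<^sub>R s *\<^sub>R S = (r * s) *\<^sub>R S" by transfer simp
  show "1 *\<^sub>R S = S" by transfer simp
  show "c *\<^sub>C (S + T) = c *\<^sub>C S + c *\<^sub>C T" by transfer (simp add: scaleC_add_right)
  show "(c + d) *\<^sub>C S = c *\<^sub>C S + d *\<^sub>C S" by transfer (simp add: scaleC_add_left)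
  show "c *\<^sub>C d *\<^sub>C S = (c * d) *\<^sub>C S" by transfer (simp add: scaleC_scaleC)
  show "1 *\<^sub>C S = S" by transfer (simp add: scaleC_one)
  show "r *\<^sub>R S = complex_of_real r *\<^sub>C S" by transfer (simp add: scaleR_scaleC)
  show "dist S T = norm (S - T)" by (rule dist_bop_def)
  show "sgn S = inverse (norm S) *\<^sub>R S" by (rule sgn_bop_def)
  show "(uniformity :: ('a bop \<times> 'a bop) filter) = (INF e\<in>{0 <..}. principal {(S, T). dist S T < e})"
    by (rule uniformity_bop_def)
  show "open U = (\<forall>S\<in>U. \<forall>\<^sub>F (S', T) in uniformity. S' = S \<longrightarrow> T \<in> U)" for U :: "'a bop set"
    by (rule open_bop_def)
  show "norm S = 0 \<longleftrightarrow> S = 0" by transfer (simp add: onorm_eq_0 fun_eq_iff)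
  show "norm (S + T) \<le> norm S + norm T" by transfer (simp add: onorm_triangle)
  show "norm (r *\<^sub>R S) = \<bar>r\<bar> * norm S" by transfer (simp add: onorm_scaleR)
qed

end

text \<open>The unit is the identity operator, and multiplication is composition. (The trivial space
  \<open>H = 0\<close> is admitted, so there is no instance of \<^class>\<open>ring_1\<close>.)\<close>

instantiation bop :: (complex_hilbert_space) "{ring, monoid_mult}"
begin

lift_definition one_bop :: "'a bop" is "\<lambda>x. x"
  by simp

lift_definition times_bop :: "'a bop \<Rightarrow> 'a bop \<Rightarrow> 'a bop" is "\<lambda>S T x. S (T x)"
  by (simp add: bounded_linear_compose)

instance
proof
  fix S T R :: "'a bop"
  show "S * T * R = S * (T * R)" by transfer simp
  show "1 * S = S" by transfer simp
  show "S * 1 = S" by transfer simp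
  show "(S + T) * R = S * R + T * R" by transfer simp
  show "S * (T + R) = S * T + S * R"
    by transfer (simp add: linear_simps)
qed

end

text \<open>The definite description in the definition of the adjoint below is justified by the Riesz
  representation theorem; see \<open>cinner_adj\<close>.\<close>

definition adj :: "'h::complex_hilbert_space bop \<Rightarrow> 'h bop" where
  "adj T = (THE S. \<forall>x y. cinner (op_apply T x) y = cinner x (op_apply S y))"

lemma cinner_add_right: "cinner z (x + y) = cinner z x + cinner z (y :: 'h::complex_hilbert_space)"
  by (metis cinner_add_left cinner_commute complex_cnj_add)

lemma cinner_scaleC_right: "cinner x (c *\<^sub>C y) = cnj c * cinner x (y :: 'h::complex_hilbert_space)"
  by (metis cinner_commute cinner_scaleC_left complex_cnj_mult)

lemma cinner_diff_left: "cinner (x - y) z = cinner x z - cinner y (z :: 'h::complex_hilbert_space)"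
  using cinner_add_left[of "x - y" y z] by simp

lemma cinner_ext:
  fixes y z :: "'h::complex_hilbert_space"
  assumes "\<And>x. cinner x y = cinner x z"
  shows "y = z"
proof -
  have "cinner (y - z) (y - z) = 0"
    using cinner_add_right[of "y - z" "y - z" z] assms[of "y - z"] by simp
  then show ?thesis by (simp add: cinner_self)
qed

lemma norm_add_sq:
  "(norm (x + y))\<^sup>2 = (norm x)\<^sup>2 + 2 * Re (cinner x y) + (norm (y :: 'h::complex_hilbert_space))\<^sup>2"
proof -
  have "complex_of_real ((norm (x + y))\<^sup>2) = cinner x x + (cinner x y + cinner y x) + cinner y y"
    by (simp only: cinner_self[symmetric] cinner_add_left cinner_add_right add_ac)
  also have "cinner x y + cinner y x = complex_of_real (2 * Re (cinner x y))"
    by (subst cinner_commute[of y x]) (simp add: complex_add_cnj)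
  finally have "complex_of_real ((norm (x + y))\<^sup>2)
      = complex_of_real ((norm x)\<^sup>2 + 2 * Re (cinner x y) + (norm y)\<^sup>2)"
    by (simp add: cinner_self)
  then show ?thesis by (simp only: of_real_eq_iff)
qed

lemma cinner_minus_right: "cinner x (- y) = - cinner x (y :: 'h::complex_hilbert_space)"
  using cinner_scaleC_right[of x "- 1" y] by (simp add: scaleC_one)

lemma parallelogram:
  "(norm (x - y))\<^sup>2 = 2 * (norm x)\<^sup>2 + 2 * (norm y)\<^sup>2 - (norm (x + y :: 'h::complex_hilbert_space))\<^sup>2"
  using norm_add_sq[of x y] norm_add_sq[of x "- y"] by (simp add: cinner_minus_right)

lemma cinner_eq_0_if_norm_le:
  fixes x z :: "'h::complex_hilbert_space"
  assumes "\<And>c. norm x \<le> norm (x + c *\<^sub>C z)"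
  shows "cinner x z = 0"
proof (cases "z = 0")
  case True
  then show ?thesis by (metis add_cancel_right_right cinner_add_right)
next
  case False
  define a where "a = cinner x z"
  define N where "N = (norm z)\<^sup>2"
  have N: "N > 0" using False by (simp add: N_def)
  define c where "c = - a / complex_of_real N"
  have "(norm x)\<^sup>2 \<le> (norm (x + c *\<^sub>C z))\<^sup>2"
    using assms by (simp add: power_mono)
  then have "0 \<le> 2 * Re (cnj c * a) + (cmod c)\<^sup>2 * N"
    by (simp add: norm_add_sq cinner_scaleC_right norm_scaleC power_mult_distrib a_def N_def)
  also have "Re (cnj c * a) = - ((cmod a)\<^sup>2 / N)"
    unfolding c_def cmod_power2 by (simp add: power2_eq_square add_divide_distrib)
  also have "(cmod c)\<^sup>2 * N = (cmod a)\<^sup>2 / N"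
    unfolding c_def using N by (simp add: norm_divide power_divide power2_eq_square)
  finally have "(cmod a)\<^sup>2 / N \<le> 0" by simp
  then show ?thesis using N by (simp add: divide_le_0_iff a_def)
qed

lemma Cauchy_Schwarz_cinner: "cmod (cinner x y) \<le> norm x * norm (y :: 'h::complex_hilbert_space)"
proof (cases "y = 0")
  case True
  then show ?thesis by (metis add_cancel_right_right cinner_add_right mult_zero_right norm_zero order_refl)
next
  case False
  define a where "a = cinner x y"
  define N where "N = (norm y)\<^sup>2"
  have N: "N > 0" using False by (simp add: N_def)
  define c where "c = - a / complex_of_real N"
  have "0 \<le> (norm (x + c *\<^sub>C y))\<^sup>2" by simp
  also have "\<dots> = (norm x)\<^sup>2 + 2 * Re (cnj c * a) + (cmod c)\<^sup>2 * N"
    by (simp add: norm_add_sq cinner_scaleC_right norm_scaleC power_mult_distrib a_def N_def)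
  also have "Re (cnj c * a) = - ((cmod a)\<^sup>2 / N)"
    unfolding c_def cmod_power2 by (simp add: power2_eq_square add_divide_distrib)
  also have "(cmod c)\<^sup>2 * N = (cmod a)\<^sup>2 / N"
    unfolding c_def using N by (simp add: norm_divide power_divide power2_eq_square)
  finally have "(cmod a)\<^sup>2 \<le> (norm x * norm y)\<^sup>2"
    using N by (simp add: field_simps N_def)
  then show ?thesis unfolding a_def by (rule power2_le_imp_le) simp
qed

lemma riesz_representation:
  fixes f :: "'h::complex_hilbert_space \<Rightarrow> complex"
  assumes f: "bounded_linear f" and fC: "\<And>c x. f (c *\<^sub>C x) = c * f x"
  shows "\<exists>y. \<forall>x. f x = cinner x y"
proof (cases "\<forall>x. f x = 0")
  case True
  have "cinner x 0 = 0" for x :: 'h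
    by (metis add_cancel_right_right cinner_add_right)
  then show ?thesis using True by metis
next
  case False
  then obtain w where w: "f w \<noteq> 0" by blast
  interpret f: bounded_linear f by (rule f)
  define C where "C = {x. f x = 1}"
  define d where "d = Inf (norm ` C)"
  have "inverse (f w) *\<^sub>C w \<in> C" using w by (simp add: C_def fC)
  then have ne: "norm ` C \<noteq> {}" by blast
  have bdd: "bdd_below (norm ` C)" by (rule bdd_belowI2[of _ 0]) simp
  have d_le: "d \<le> norm x" if "x \<in> C" for x
    unfolding d_def by (rule cInf_lower[OF _ bdd]) (use that in simp)
  have d0: "0 \<le> d" unfolding d_def by (rule cInf_greatest[OF ne]) auto
  have "\<exists>x\<in>C. norm x < d + inverse (real (Suc n))" for n
    using cInf_lessD[OF ne, of "d + inverse (real (Suc n))"] by (auto simp: d_def)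
  then obtain X where XC: "\<And>n. X n \<in> C" and X: "\<And>n. norm (X n) < d + inverse (real (Suc n))"
    by metis
  have sum_ge: "2 * d \<le> norm (x + y)" if "x \<in> C" "y \<in> C" for x y
  proof -
    have "(1 / 2) *\<^sub>R (x + y) \<in> C"
      using that by (simp add: C_def f.scaleR f.add scaleR_conv_of_real)
    from d_le[OF this] show ?thesis by simp
  qed
  have lim: "(\<lambda>n. norm (X n)) \<longlonglongrightarrow> d"
  proof (rule tendsto_sandwich[of "\<lambda>_. d" _ _ "\<lambda>n. d + inverse (real (Suc n))"])
    show "(\<lambda>n. d + inverse (real (Suc n))) \<longlonglongrightarrow> d"
      using tendsto_add[OF tendsto_const LIMSEQ_inverse_real_of_nat, of d] by simp
  qed (use d_le XC X in \<open>auto intro!: always_eventually less_imp_le simp del: of_nat_Suc\<close>)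
  have "Cauchy X"
  proof (rule metric_CauchyI)
    fix e :: real assume e: "0 < e"
    have "(\<lambda>n. (norm (X n))\<^sup>2) \<longlonglongrightarrow> d\<^sup>2"
      by (intro tendsto_intros lim)
    then have "\<forall>\<^sub>F n in sequentially. (norm (X n))\<^sup>2 < d\<^sup>2 + e\<^sup>2 / 4"
      by (rule order_tendstoD) (use e in simp)
    then obtain M where M: "\<And>n. n \<ge> M \<Longrightarrow> (norm (X n))\<^sup>2 < d\<^sup>2 + e\<^sup>2 / 4"
      by (auto simp: eventually_sequentially)
    have "dist (X m) (X n) < e" if "m \<ge> M" "n \<ge> M" for m n
    proof -
      have "(2 * d)\<^sup>2 \<le> (norm (X m + X n))\<^sup>2"
        using sum_ge[OF XC XC] d0 by (intro power_mono) auto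
      then have "(norm (X m - X n))\<^sup>2 < e\<^sup>2"
        using parallelogram[of "X m" "X n"] M[OF that(1)] M[OF that(2)] by (simp add: power_mult_distrib)
      then show ?thesis unfolding dist_norm by (rule power2_less_imp_less) (use e in simp)
    qed
    then show "\<exists>M. \<forall>m\<ge>M. \<forall>n\<ge>M. dist (X m) (X n) < e" by blast
  qed
  then obtain u where u: "X \<longlonglongrightarrow> u"
    by (auto simp: Cauchy_convergent_iff convergent_def)
  have "(\<lambda>n. f (X n)) \<longlonglongrightarrow> f u" by (rule f.tendsto[OF u])
  moreover have "f (X n) = 1" for n using XC by (simp add: C_def)
  ultimately have fu: "f u = 1" by (simp add: LIMSEQ_const_iff)
  have nu: "norm u = d"
    using LIMSEQ_unique[OF tendsto_norm[OF u] lim] .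
  have orth: "cinner u z = 0" if "f z = 0" for z
  proof (rule cinner_eq_0_if_norm_le)
    show "norm u \<le> norm (u + c *\<^sub>C z)" for c
      unfolding nu by (rule d_le) (simp add: C_def f.add fC fu that)
  qed
  have "u \<noteq> 0" using fu f.zero by auto
  then have N: "complex_of_real ((norm u)\<^sup>2) \<noteq> 0" by simp
  have "f x = cinner x (complex_of_real (inverse ((norm u)\<^sup>2)) *\<^sub>C u)" for x
  proof -
    have "cinner u (x - f x *\<^sub>C u) = 0"
      by (rule orth) (simp add: f.diff fC fu)
    then have "cinner (x - f x *\<^sub>C u) u = 0"
      by (metis cinner_commute complex_cnj_zero)
    then have "cinner x u = f x * complex_of_real ((norm u)\<^sup>2)"
      by (simp add: cinner_diff_left cinner_scaleC_left cinner_self)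
    then show ?thesis using N by (simp add: cinner_scaleC_right field_simps)
  qed
  then show ?thesis by blast
qed

lemma cinner_adj: "cinner (op_apply T x) y = cinner x (op_apply (adj T) y)"
proof -
  interpret T: bounded_linear "op_apply T" by (rule bounded_linear_op_apply)
  have "\<exists>z. \<forall>x. cinner (op_apply T x) y = cinner x z" for y
  proof (rule riesz_representation)
    obtain K where K: "\<And>x. norm (op_apply T x) \<le> norm x * K"
      using T.bounded by blast
    show "bounded_linear (\<lambda>x. cinner (op_apply T x) y)"
    proof (rule bounded_linear_intro[where K = "K * norm y"])
      show "cmod (cinner (op_apply T x) y) \<le> norm x * (K * norm y)" for x
        using order_trans[OF Cauchy_Schwarz_cinner mult_right_mono[OF K norm_ge_zero]]
        by (simp add: mult.assoc)
    qed (simp_all add: T.add T.scaleR cinner_add_left scaleR_scaleC cinner_scaleC_left op_apply_scaleC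
        scaleR_conv_of_real)
  qed (simp add: op_apply_scaleC cinner_scaleC_left)
  then obtain g where g: "\<And>x y. cinner (op_apply T x) y = cinner x (g y)" by metis
  obtain K where K: "\<And>x. norm (op_apply T x) \<le> norm x * K" and "0 \<le> K"
    using T.nonneg_bounded by blast
  have gC: "g (c *\<^sub>C y) = c *\<^sub>C g y" for c y
    by (rule cinner_ext) (simp add: g[symmetric] cinner_scaleC_right)
  have "bounded_linear g"
  proof (rule bounded_linear_intro[where K = K])
    show "g (x + y) = g x + g y" for x y
      by (rule cinner_ext) (simp add: g[symmetric] cinner_add_right)
    show "g (r *\<^sub>R x) = r *\<^sub>R g x" for r x
      by (simp add: scaleR_scaleC gC)
    show "norm (g y) \<le> norm y * K" for y
    proof (cases "g y = 0")
      case True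
      then show ?thesis using \<open>0 \<le> K\<close> by simp
    next
      case False
      have "(norm (g y))\<^sup>2 = cmod (cinner (op_apply T (g y)) y)"
        by (simp only: g cinner_self norm_of_real abs_power2 abs_norm_cancel)
      also have "\<dots> \<le> norm (g y) * K * norm y"
        using order_trans[OF Cauchy_Schwarz_cinner mult_right_mono[OF K norm_ge_zero]] .
      finally show ?thesis using False by (simp add: power2_eq_square mult.assoc mult.commute)
    qed
  qed
  then have "op_apply (Op g) = g" by (simp add: Op_inverse gC)
  then have ex: "\<forall>x y. cinner (op_apply T x) y = cinner x (op_apply (Op g) y)" by (simp add: g)
  have "\<forall>x y. cinner (op_apply T x) y = cinner x (op_apply (adj T) y)"
    unfolding adj_def
  proof (rule theI)
    show "\<forall>x y. cinner (op_apply T x) y = cinner x (op_apply (Op g) y)" by (rule ex)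
    show "S = Op g" if "\<forall>x y. cinner (op_apply T x) y = cinner x (op_apply S y)" for S
      by (rule bop_eqI, rule cinner_ext) (metis that ex)
  qed
  then show ?thesis by blast
qed


section \<open>Operator systems and generated C*-algebras\<close>

definition operator_system :: "'h::complex_hilbert_space bop set \<Rightarrow> bool" where
  "operator_system S \<longleftrightarrow> csubspace S \<and> 1 \<in> S \<and> (\<forall>s\<in>S. adj s \<in> S)"

definition cstar_subalgebra :: "'h::complex_hilbert_space bop set \<Rightarrow> bool" where
  "cstar_subalgebra A \<longleftrightarrow>
     csubspace A \<and> (\<forall>a\<in>A. \<forall>b\<in>A. a * b \<in> A) \<and> (\<forall>a\<in>A. adj a \<in> A) \<and> closed A"

definition cstar_generated :: "'h::complex_hilbert_space bop set \<Rightarrow> 'h bop set" where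
  "cstar_generated S = cstar_subalgebra hull S"


section \<open>Unital completely positive maps\<close>

text \<open>Positivity of \<open>(a i j)\<close>, \<open>i, j < n\<close>, as an operator on the \<open>n\<close>-fold direct sum of the
  Hilbert space: the sum below is the inner product of the image of \<open>(\<xi> 0, \<dots>, \<xi> (n - 1))\<close> with
  that vector.\<close>

definition pos_matrix :: "nat \<Rightarrow> (nat \<Rightarrow> nat \<Rightarrow> 'h::complex_hilbert_space bop) \<Rightarrow> bool" where
  "pos_matrix n a \<longleftrightarrow>
     (\<forall>\<xi> :: nat \<Rightarrow> 'h. (\<Sum>i<n. cinner (\<Sum>j<n. op_apply (a i j) (\<xi> j)) (\<xi> i)) \<in> \<real>\<^sub>\<ge>\<^sub>0)"

text \<open>Maps defined on a subset \<open>A\<close> are total functions of which only the values on \<open>A\<close> matter.\<close>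

definition linear_map_on ::
    "'h::complex_hilbert_space bop set \<Rightarrow> ('h bop \<Rightarrow> 'h bop) \<Rightarrow> bool" where
  "linear_map_on A \<phi> \<longleftrightarrow>
     (\<forall>a\<in>A. \<forall>b\<in>A. \<phi> (a + b) = \<phi> a + \<phi> b) \<and> (\<forall>c. \<forall>a\<in>A. \<phi> (c *\<^sub>C a) = c *\<^sub>C \<phi> a)"

definition completely_positive_on ::
    "'h::complex_hilbert_space bop set \<Rightarrow> ('h bop \<Rightarrow> 'h bop) \<Rightarrow> bool" where
  "completely_positive_on A \<phi> \<longleftrightarrow> linear_map_on A \<phi> \<and>
     (\<forall>n a. (\<forall>i<n. \<forall>j<n. a i j \<in> A) \<and> pos_matrix n a \<longrightarrow> pos_matrix n (\<lambda>i j. \<phi> (a i j)))"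

definition ucp_on :: "'h::complex_hilbert_space bop set \<Rightarrow> ('h bop \<Rightarrow> 'h bop) \<Rightarrow> bool" where
  "ucp_on A \<phi> \<longleftrightarrow> completely_positive_on A \<phi> \<and> \<phi> 1 = 1"

definition S_map :: "'h::complex_hilbert_space bop set \<Rightarrow> ('h bop \<Rightarrow> 'h bop) \<Rightarrow> bool" where
  "S_map S \<phi> \<longleftrightarrow> ucp_on UNIV \<phi> \<and> (\<forall>s\<in>S. \<phi> s = s)"

definition S_projection :: "'h::complex_hilbert_space bop set \<Rightarrow> ('h bop \<Rightarrow> 'h bop) \<Rightarrow> bool" where
  "S_projection S \<theta> \<longleftrightarrow> S_map S \<theta> \<and> \<theta> \<circ> \<theta> = \<theta>"

definition proj_le :: "('h::complex_hilbert_space bop \<Rightarrow> 'h bop) \<Rightarrow> ('h bop \<Rightarrow> 'h bop) \<Rightarrow> bool"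
    (infix \<open>\<prec>\<close> 50) where
  "\<psi> \<prec> \<theta> \<longleftrightarrow> \<psi> \<circ> \<theta> = \<psi> \<and> \<theta> \<circ> \<psi> = \<psi>"

definition minimal_S_projection ::
    "'h::complex_hilbert_space bop set \<Rightarrow> ('h bop \<Rightarrow> 'h bop) \<Rightarrow> bool" where
  "minimal_S_projection S \<theta> \<longleftrightarrow>
     S_projection S \<theta> \<and> (\<forall>\<psi>. S_projection S \<psi> \<and> \<psi> \<prec> \<theta> \<longrightarrow> \<psi> = \<theta>)"


section \<open>Abnormalities and the expanse\<close>

definition abnormalities :: "'h::complex_hilbert_space bop set \<Rightarrow> 'h bop set" where
  "abnormalities S = {\<phi> a - a | \<phi> a.
     a \<in> cstar_generated S \<and> ucp_on (cstar_generated S) \<phi> \<and> (\<forall>s\<in>S. \<phi> s = s)}"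

definition expanse :: "'h::complex_hilbert_space bop set \<Rightarrow> 'h bop set" where
  "expanse S = cspan (\<Union>\<phi>\<in>{\<phi>. S_map S \<phi>}. \<phi> ` cstar_generated S)"

end

theory Submission
  imports Defs "HOL-Library.Poly_Mapping"
begin

text \<open>
The theorem follows from the assertion that a minimal \<open>S\<close>-projection \<open>\<theta>\<close> satisfies
\<open>\<theta> (\<phi> a) = \<theta> a\<close> for every \<open>S\<close>-map \<open>\<phi>\<close> and every \<open>a\<close> in the algebra \<open>A\<close> generated by \<open>S\<close>
(\<open>minimal_S_projection_absorbs\<close>). Granted this, \<open>\<theta>\<close> kills every abnormality \<open>\<phi> a - a\<close>, because
\<open>\<phi>\<close> extends from \<open>A\<close> to an \<open>S\<close>-map by Arveson's theorem (\<open>arveson_extension\<close>); the extension also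
places \<open>\<phi> a\<close> in the expanse. Conversely, an element of the expanse differs from some \<open>a \<in> A\<close> by a
linear combination of abnormalities; if \<open>\<theta>\<close> kills the element, then it kills \<open>a\<close>, and
\<open>a = - (\<theta> a - a)\<close> is itself the negative of an abnormality.

Absorption rests on two facts. The first is rigidity, \<open>\<theta> \<circ> \<phi> \<circ> \<theta> = \<theta>\<close>
(\<open>minimal_S_projection_rigid\<close>). The \<open>S\<close>-maps form a convex semigroup that is compact in the
point-weak topology and in which right translations are continuous. Hence there is a minimal left
ideal of maps of the form \<open>\<phi> \<circ> \<theta>\<close>. Averaging the powers of an element shows that in such an
ideal \<open>h \<circ> k = h\<close>, and minimality of \<open>\<theta>\<close> forces \<open>\<theta>\<close> to lie in it.

By rigidity \<open>\<theta>\<close> and \<open>\<theta> \<circ> \<phi>\<close> are idempotent maps with the same range \<open>R\<close>. The second fact is that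
two such maps agree on \<open>A\<close> (\<open>same_range_eq_on_cstar_generated\<close>): the Schwarz inequality in both
directions shows that they define the same Choi-Effros product on \<open>R\<close>, and the Choi-Effros identity
\<open>\<theta> (s b) = \<theta> (s \<theta> b)\<close> for \<open>s \<in> S\<close> computes either map on a word in \<open>S\<close> from this product.

Both Arveson's theorem and compactness use the description of a completely positive map by its
form \<open>(a, x, y) \<mapsto> \<langle>\<phi> a x, y\<rangle>\<close>. Positivity of such a form already implies that it is bounded, so that
every form with the algebraic properties of a unital completely positive map comes from one
(\<open>ucp_form_imp_ucp\<close>). Arveson's theorem then becomes an instance of the extension theorem of
M. Riesz for positive functionals, applied to finitely supported matrices of operators.
\<close>

section \<open>Bounded operators\<close>

lemma cinner_zero_left [simp]: "cinner 0 (y :: 'h::complex_hilbert_space) = 0"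
  using cinner_diff_left[of 0 0 y] by simp

lemma cinner_zero_right [simp]: "cinner (x :: 'h::complex_hilbert_space) 0 = 0"
  using cinner_commute[of x 0] by simp

lemma cinner_sum_left: "cinner (\<Sum>i\<in>I. f i) (y :: 'h::complex_hilbert_space) = (\<Sum>i\<in>I. cinner (f i) y)"
  by (induction I rule: infinite_finite_induct) (simp_all add: cinner_add_left)

lemma cinner_sum_right: "cinner (x :: 'h::complex_hilbert_space) (\<Sum>i\<in>I. f i) = (\<Sum>i\<in>I. cinner x (f i))"
  by (induction I rule: infinite_finite_induct) (simp_all add: cinner_add_right)

lemma cinner_minus_left: "cinner (- x) y = - cinner x (y :: 'h::complex_hilbert_space)"
  using cinner_diff_left[of 0 x y] by simp

lemma op_apply_add_arg: "op_apply T (x + y) = op_apply T x + op_apply T y"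
  and op_apply_minus_arg: "op_apply T (- x) = - op_apply T x"
  and op_apply_zero_arg [simp]: "op_apply T 0 = 0"
  and op_apply_sum_arg: "op_apply T (\<Sum>i\<in>I. f i) = (\<Sum>i\<in>I. op_apply T (f i))"
  using bounded_linear.linear[OF bounded_linear_op_apply[of T]]
  by (simp_all add: linear_add linear_neg linear_0 linear_sum)

lemma op_apply_add: "op_apply (S + T) x = op_apply S x + op_apply T x"
  by transfer simp

lemma op_apply_diff: "op_apply (S - T) x = op_apply S x - op_apply T x"
  by transfer simp

lemma op_apply_zero [simp]: "op_apply 0 x = 0"
  by transfer simp

lemma op_apply_scaleC_op: "op_apply (c *\<^sub>C T) x = c *\<^sub>C op_apply T x"
  by transfer simp

lemma op_apply_one [simp]: "op_apply 1 x = x"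
  by transfer simp

lemma op_apply_mult: "op_apply (S * T) x = op_apply S (op_apply T x)"
  by transfer simp

lemma op_apply_sum: "op_apply (\<Sum>i\<in>I. T i) x = (\<Sum>i\<in>I. op_apply (T i) x)"
  by (induction I rule: infinite_finite_induct) (simp_all add: op_apply_add)

lemma norm_op_apply_le: "norm (op_apply T x) \<le> norm T * norm x"
  by transfer (simp add: onorm)

lemma norm_op_leI:
  assumes "0 \<le> K" and "\<And>x. norm (op_apply T x) \<le> K * norm x"
  shows "norm T \<le> K"
  using assms by transfer (simp add: onorm_bound)

lemma norm_op_le_if_form_le:
  assumes "0 \<le> K" and form: "\<And>x y. cmod (cinner (op_apply T x) y) \<le> K * norm x * norm y"
  shows "norm T \<le> K"
proof (rule norm_op_leI[OF assms(1)])
  fix x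
  let ?y = "op_apply T x"
  have "norm ?y * norm ?y \<le> (K * norm x) * norm ?y"
    using form[of x ?y] by (simp add: cinner_self power2_eq_square norm_mult)
  then show "norm ?y \<le> K * norm x"
    using \<open>0 \<le> K\<close> by (cases "norm ?y = 0") auto
qed

lemma norm_bop_mult_le: "norm (S * T) \<le> norm S * norm (T :: 'h::complex_hilbert_space bop)"
proof (rule norm_op_leI)
  show "norm (op_apply (S * T) x) \<le> norm S * norm T * norm x" for x
    using order_trans[OF norm_op_apply_le mult_left_mono[OF norm_op_apply_le norm_ge_zero]]
    by (simp add: op_apply_mult mult.assoc)
qed simp

lemma bop_eqI_form:
  assumes "\<And>x y. cinner (op_apply S x) y = cinner (op_apply T x) y"
  shows "S = T"
  by (rule bop_eqI, rule cinner_ext) (metis assms cinner_commute)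

lemma cinner_adj_left: "cinner (op_apply (adj T) x) y = cinner x (op_apply T y)"
  by (metis cinner_adj cinner_commute)

lemma adj_adj [simp]: "adj (adj T) = T"
  by (rule bop_eqI_form) (simp add: cinner_adj_left cinner_adj[symmetric])

lemma adj_add: "adj (S + T) = adj S + adj T"
  by (rule bop_eqI_form) (simp add: cinner_adj_left cinner_add_left cinner_add_right op_apply_add)

lemma adj_scaleC: "adj (c *\<^sub>C T) = cnj c *\<^sub>C adj T"
  by (rule bop_eqI_form)
    (simp add: cinner_adj_left cinner_scaleC_left cinner_scaleC_right op_apply_scaleC_op)

lemma adj_mult: "adj (S * T) = adj T * adj S"
  by (rule bop_eqI_form) (simp add: cinner_adj_left op_apply_mult)

lemma adj_one [simp]: "adj 1 = 1"
  by (rule bop_eqI_form) (simp add: cinner_adj_left)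

lemma adj_zero [simp]: "adj 0 = 0"
  by (rule bop_eqI_form) (simp add: cinner_adj_left)

lemma norm_adj_le: "norm (adj T) \<le> norm T"
proof (rule norm_op_le_if_form_le)
  show "cmod (cinner (op_apply (adj T) x) y) \<le> norm T * norm x * norm y" for x y
  proof -
    have "cmod (cinner (op_apply (adj T) x) y) \<le> norm x * norm (op_apply T y)"
      unfolding cinner_adj_left by (rule Cauchy_Schwarz_cinner)
    also have "\<dots> \<le> norm x * (norm T * norm y)"
      by (intro mult_left_mono norm_op_apply_le norm_ge_zero)
    finally show ?thesis by (simp add: mult_ac)
  qed
qed simp

lemma scaleC_mult_left: "(c *\<^sub>C S) * T = c *\<^sub>C (S * (T :: 'h::complex_hilbert_space bop))"
  by (rule bop_eqI) (simp add: op_apply_mult op_apply_scaleC_op)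

lemma scaleC_mult_right: "S * (c *\<^sub>C T) = c *\<^sub>C (S * (T :: 'h::complex_hilbert_space bop))"
  by (rule bop_eqI) (simp add: op_apply_mult op_apply_scaleC_op op_apply_scaleC)

text \<open>The vector \<open>g y\<close> that represents the functional \<open>x \<mapsto> F x y\<close> depends linearly and continuously
  on \<open>y\<close>, and the operator is the adjoint of \<open>g\<close>.\<close>

lemma bounded_sesquilinear_form_operator:
  fixes F :: "'h::complex_hilbert_space \<Rightarrow> 'h \<Rightarrow> complex"
  assumes "\<And>x x' y. F (x + x') y = F x y + F x' y" and "\<And>c x y. F (c *\<^sub>C x) y = c * F x y"
    and "\<And>x y y'. F x (y + y') = F x y + F x y'" and "\<And>c x y. F x (c *\<^sub>C y) = cnj c * F x y"
    and bound: "\<And>x y. cmod (F x y) \<le> K * norm x * norm y" and "0 \<le> K"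
  shows "\<exists>T. \<forall>x y. F x y = cinner (op_apply T x) y"
proof -
  have "\<exists>z. \<forall>x. F x y = cinner x z" for y
  proof (rule riesz_representation)
    show "bounded_linear (\<lambda>x. F x y)"
    proof (rule bounded_linear_intro[where K = "K * norm y"])
      show "cmod (F x y) \<le> norm x * (K * norm y)" for x
        using bound[of x y] by (simp add: mult_ac)
    qed (simp_all add: assms scaleR_scaleC scaleR_conv_of_real)
  qed (simp add: assms)
  then obtain g where g: "\<And>x y. F x y = cinner x (g y)" by metis
  have gC: "g (c *\<^sub>C y) = c *\<^sub>C g y" for c y
    by (rule cinner_ext) (simp add: g[symmetric] cinner_scaleC_right assms)
  have "bounded_linear g"
  proof (rule bounded_linear_intro[where K = K])
    show "g (x + y) = g x + g y" for x y
      by (rule cinner_ext) (simp add: g[symmetric] cinner_add_right assms)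
    show "g (r *\<^sub>R x) = r *\<^sub>R g x" for r x
      by (simp add: scaleR_scaleC gC)
    show "norm (g y) \<le> norm y * K" for y
    proof (cases "g y = 0")
      case False
      have "norm (g y) * norm (g y) \<le> norm (g y) * (K * norm y)"
        using bound[of "g y" y] by (simp add: g cinner_self power2_eq_square norm_mult mult_ac)
      then show ?thesis using False by (simp add: mult_ac)
    qed (simp add: \<open>0 \<le> K\<close>)
  qed
  then have "op_apply (Op g) = g" by (simp add: Op_inverse gC)
  then have "F x y = cinner (op_apply (adj (Op g)) x) y" for x y
    by (simp add: g cinner_adj_left)
  then show ?thesis by blast
qed


section \<open>Completely positive maps as forms\<close>

definition form_of :: "('h::complex_hilbert_space bop \<Rightarrow> 'h bop) \<Rightarrow> 'h bop \<Rightarrow> 'h \<Rightarrow> 'h \<Rightarrow> complex" where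
  "form_of \<phi> a x y = cinner (op_apply (\<phi> a) x) y"

text \<open>The positivity clause is \<^const>\<open>pos_matrix\<close> for the matrix of the operators that the
  sesquilinear forms \<open>F (a i j)\<close> will turn out to have.\<close>

definition ucp_form ::
    "'h::complex_hilbert_space bop set \<Rightarrow> ('h bop \<Rightarrow> 'h \<Rightarrow> 'h \<Rightarrow> complex) \<Rightarrow> bool" where
  "ucp_form D F \<longleftrightarrow>
     (\<forall>a\<in>D. \<forall>b\<in>D. \<forall>x y. F (a + b) x y = F a x y + F b x y) \<and>
     (\<forall>c. \<forall>a\<in>D. \<forall>x y. F (c *\<^sub>C a) x y = c * F a x y) \<and>
     (\<forall>a\<in>D. \<forall>x x' y. F a (x + x') y = F a x y + F a x' y) \<and>
     (\<forall>a\<in>D. \<forall>c x y. F a (c *\<^sub>C x) y = c * F a x y) \<and>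
     (\<forall>a\<in>D. \<forall>x y y'. F a x (y + y') = F a x y + F a x y') \<and>
     (\<forall>a\<in>D. \<forall>c x y. F a x (c *\<^sub>C y) = cnj c * F a x y) \<and>
     (\<forall>n a. (\<forall>i<n. \<forall>j<n. a i j \<in> D) \<and> pos_matrix n a \<longrightarrow>
        (\<forall>\<xi>. (\<Sum>i<n. \<Sum>j<n. F (a i j) (\<xi> j) (\<xi> i)) \<in> \<real>\<^sub>\<ge>\<^sub>0)) \<and>
     (\<forall>x y. F 1 x y = cinner x y)"

lemma pos_matrix_iff:
  "pos_matrix n a \<longleftrightarrow> (\<forall>\<xi>. (\<Sum>i<n. \<Sum>j<n. cinner (op_apply (a i j) (\<xi> j)) (\<xi> i)) \<in> \<real>\<^sub>\<ge>\<^sub>0)"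
  by (simp add: pos_matrix_def cinner_sum_left)

lemma ucp_form_form_of:
  assumes "ucp_on D \<phi>"
  shows "ucp_form D (form_of \<phi>)"
  using assms unfolding ucp_on_def completely_positive_on_def linear_map_on_def ucp_form_def
    form_of_def pos_matrix_iff
  by (simp add: cinner_add_left cinner_add_right cinner_scaleC_left cinner_scaleC_right
      op_apply_add op_apply_add_arg op_apply_scaleC op_apply_scaleC_op)

lemma ucp_form_pos:
  assumes "ucp_form D F" and "\<And>i j. i < n \<Longrightarrow> j < n \<Longrightarrow> a i j \<in> D" and "pos_matrix n a"
  shows "(\<Sum>i<n. \<Sum>j<n. F (a i j) (\<xi> j) (\<xi> i)) \<in> \<real>\<^sub>\<ge>\<^sub>0"
proof -
  have "\<forall>n a. (\<forall>i<n. \<forall>j<n. a i j \<in> D) \<and> pos_matrix n a \<longrightarrow>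
      (\<forall>\<xi>. (\<Sum>i<n. \<Sum>j<n. F (a i j) (\<xi> j) (\<xi> i)) \<in> \<real>\<^sub>\<ge>\<^sub>0)"
    using assms(1) unfolding ucp_form_def by (elim conjE)
  then show ?thesis using assms(2,3) by simp
qed

lemma operator_system_UNIV: "operator_system UNIV"
  by (simp add: operator_system_def)

text \<open>The matrix with rows \<open>(c, a)\<close> and \<open>(a\<^sup>*, c)\<close>, where \<open>c = \<parallel>a\<parallel>\<close>, is positive by the
  Cauchy-Schwarz inequality. Its image under \<open>F\<close> is real, which yields that \<open>F\<close> respects adjoints,
  and nonnegative, which yields that \<open>F\<close> is contractive.\<close>

lemma pos_matrix_norm_block:
  "pos_matrix 2 (\<lambda>i j. if i = j then complex_of_real (norm a) *\<^sub>C 1 else if i = 0 then a else adj a)"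
  unfolding pos_matrix_iff
proof
  fix \<xi> :: "nat \<Rightarrow> 'a"
  let ?c = "norm a" and ?u = "\<xi> 0" and ?v = "\<xi> 1"
  let ?z = "cinner (op_apply a ?v) ?u"
  have "cmod ?z \<le> ?c * (norm ?u * norm ?v)"
    using order_trans[OF Cauchy_Schwarz_cinner mult_right_mono[OF norm_op_apply_le norm_ge_zero],
        of a ?v ?u] by (simp add: mult_ac)
  moreover have "2 * (norm ?u * norm ?v) \<le> (norm ?u)\<^sup>2 + (norm ?v)\<^sup>2"
    using sum_squares_bound[of "norm ?u" "norm ?v"] by simp
  then have "?c * (2 * (norm ?u * norm ?v)) \<le> ?c * ((norm ?u)\<^sup>2 + (norm ?v)\<^sup>2)"
    by (intro mult_left_mono) simp_all
  moreover have "- cmod ?z \<le> Re ?z"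
    using abs_Re_le_cmod[of ?z] by linarith
  ultimately have "0 \<le> ?c * ((norm ?u)\<^sup>2 + (norm ?v)\<^sup>2) + 2 * Re ?z"
    by linarith
  moreover have "cinner (op_apply (adj a) ?u) ?v = cnj ?z"
    by (metis cinner_adj_left cinner_commute)
  then have "(\<Sum>i<2. \<Sum>j<2. cinner (op_apply (if i = j then complex_of_real (norm a) *\<^sub>C 1
        else if i = 0 then a else adj a) (\<xi> j)) (\<xi> i))
      = complex_of_real (?c * ((norm ?u)\<^sup>2 + (norm ?v)\<^sup>2) + 2 * Re ?z)"
    by (simp add: numeral_2_eq_2 op_apply_scaleC_op cinner_scaleC_left cinner_self complex_eq_iff
        algebra_simps)
  ultimately show "(\<Sum>i<2. \<Sum>j<2. cinner (op_apply (if i = j then complex_of_real (norm a) *\<^sub>C 1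
        else if i = 0 then a else adj a) (\<xi> j)) (\<xi> i)) \<in> \<real>\<^sub>\<ge>\<^sub>0"
    by (simp only: complex_nonneg_Reals_iff Re_complex_of_real Im_complex_of_real)
qed

lemma ucp_form_block:
  assumes D: "operator_system D" and F: "ucp_form D F" and a: "a \<in> D"
  shows "complex_of_real (norm a * ((norm x)\<^sup>2 + (norm y)\<^sup>2)) + F a x y + F (adj a) y x \<in> \<real>\<^sub>\<ge>\<^sub>0"
proof -
  let ?m = "\<lambda>i j::nat. if i = j then complex_of_real (norm a) *\<^sub>C 1 else if i = 0 then a else adj a"
  have "?m i j \<in> D" for i j
    using D a by (simp add: operator_system_def complex_vector.subspace_scale)
  then have "(\<Sum>i<2. \<Sum>j<2. F (?m i j) (if j = 0 then y else x) (if i = 0 then y else x)) \<in> \<real>\<^sub>\<ge>\<^sub>0"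
    by (intro ucp_form_pos[OF F _ pos_matrix_norm_block, where \<xi> = "\<lambda>i. if i = 0 then y else x"])
  moreover have "F (complex_of_real (norm a) *\<^sub>C 1) z z = complex_of_real (norm a * (norm z)\<^sup>2)" for z
    using F D by (simp add: ucp_form_def operator_system_def cinner_self)
  ultimately show ?thesis
    by (simp add: numeral_2_eq_2 algebra_simps)
qed

lemma ucp_form_adj:
  assumes D: "operator_system D" and F: "ucp_form D F" and a: "a \<in> D"
  shows "F (adj a) y x = cnj (F a x y)"
proof -
  have "adj a \<in> D" using D a by (simp add: operator_system_def)
  then have "F a (\<i> *\<^sub>C x) y = \<i> * F a x y" "F (adj a) y (\<i> *\<^sub>C x) = - \<i> * F (adj a) y x"
    using F a unfolding ucp_form_def by simp_all
  \<comment> \<open>The imaginary parts of the two values give the imaginary and the real part of the claim.\<close>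
  with ucp_form_block[OF assms, of x y] ucp_form_block[OF assms, of "\<i> *\<^sub>C x" y]
  show ?thesis
    by (simp add: complex_nonneg_Reals_iff complex_eq_iff)
qed

lemma ucp_form_bound:
  assumes D: "operator_system D" and F: "ucp_form D F" and a: "a \<in> D"
  shows "cmod (F a x y) \<le> norm a * norm x * norm y"
proof -
  let ?K = "norm a"
  have zero: "F a 0 y = 0" "F a x 0 = 0" for x y
    using F a complex_vector.scale_zero_left[of 0] unfolding ucp_form_def
    by (metis mult_zero_left complex_cnj_zero)+
  have unit: "cmod (F a x y) \<le> ?K" if "norm x = 1" "norm y = 1" for x y
  proof (cases "F a x y = 0")
    case False
    \<comment> \<open>Rotate \<open>x\<close> so that the value of the form becomes \<open>- cmod (F a x y)\<close>.\<close>
    define c where "c = - cnj (F a x y) / cmod (F a x y)"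
    have "cmod c = 1" using False by (simp add: c_def norm_divide)
    then have n: "norm (c *\<^sub>C x) = 1" using that by (simp add: norm_scaleC)
    have "F a (c *\<^sub>C x) y = c * F a x y"
      using F a unfolding ucp_form_def by simp
    also have "\<dots> = - complex_of_real (cmod (F a x y))"
      using False by (simp add: c_def complex_norm_square[symmetric] mult.commute power2_eq_square)
    finally have "F a (c *\<^sub>C x) y = - complex_of_real (cmod (F a x y))" .
    with ucp_form_block[OF assms, of "c *\<^sub>C x" y] ucp_form_adj[OF assms, of y "c *\<^sub>C x"] n that
    show ?thesis by (simp add: complex_nonneg_Reals_iff)
  qed simp
  show ?thesis
  proof (cases "x = 0 \<or> y = 0")
    case False
    let ?u = "complex_of_real (inverse (norm x)) *\<^sub>C x" and ?v = "complex_of_real (inverse (norm y)) *\<^sub>C y"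
    have "norm ?u = 1" "norm ?v = 1" using False by (simp_all add: norm_scaleC norm_inverse)
    then have "cmod (F a ?u ?v) \<le> ?K" by (rule unit)
    moreover have "F a ?u ?v = inverse (norm x) * inverse (norm y) * F a x y"
      using F a unfolding ucp_form_def by simp
    then have "cmod (F a ?u ?v) = cmod (F a x y) / (norm x * norm y)"
      by (simp add: norm_mult norm_inverse divide_inverse mult_ac)
    moreover have "0 < norm x * norm y" using False by simp
    ultimately show ?thesis
      by (simp only: pos_divide_le_eq mult.assoc)
  qed (auto simp: zero)
qed

lemma ucp_form_imp_ucp:
  assumes F: "ucp_form UNIV F"
  shows "\<exists>\<phi>. ucp_on UNIV \<phi> \<and> F = form_of \<phi>"
proof -
  have "\<exists>T. \<forall>x y. F a x y = cinner (op_apply T x) y" for a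
    using F ucp_form_bound[OF operator_system_UNIV F, of a] unfolding ucp_form_def
    by (intro bounded_sesquilinear_form_operator[where K = "norm a"]) simp_all
  then obtain \<phi> where \<phi>: "\<And>a x y. F a x y = cinner (op_apply (\<phi> a) x) y" by metis
  have "ucp_on UNIV \<phi>"
    unfolding ucp_on_def completely_positive_on_def linear_map_on_def pos_matrix_iff
  proof (intro conjI ballI allI impI)
    show "\<phi> (a + b) = \<phi> a + \<phi> b" for a b
      by (rule bop_eqI_form)
        (use F in \<open>simp add: ucp_form_def op_apply_add cinner_add_left flip: \<phi>\<close>)
    show "\<phi> (c *\<^sub>C a) = c *\<^sub>C \<phi> a" for c a
      by (rule bop_eqI_form)
        (use F in \<open>simp add: ucp_form_def op_apply_scaleC_op cinner_scaleC_left flip: \<phi>\<close>)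
    show "\<phi> 1 = 1"
      by (rule bop_eqI_form) (use F in \<open>simp add: ucp_form_def flip: \<phi>\<close>)
  qed (use F in \<open>simp add: ucp_form_def pos_matrix_iff flip: \<phi>\<close>)
  moreover have "F = form_of \<phi>" by (simp add: fun_eq_iff form_of_def \<phi>)
  ultimately show ?thesis by blast
qed

lemma ucp_adj:
  assumes "operator_system D" and "ucp_on D \<phi>" and "a \<in> D"
  shows "\<phi> (adj a) = adj (\<phi> a)"
proof (rule bop_eqI_form)
  show "cinner (op_apply (\<phi> (adj a)) x) y = cinner (op_apply (adj (\<phi> a)) x) y" for x y
    using ucp_form_adj[OF assms(1) ucp_form_form_of[OF assms(2)] assms(3), of x y]
    by (metis form_of_def cinner_adj_left cinner_commute)
qed

lemma ucp_norm_le: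
  assumes "operator_system D" and "ucp_on D \<phi>" and "a \<in> D"
  shows "norm (\<phi> a) \<le> norm a"
  using ucp_form_bound[OF assms(1) ucp_form_form_of[OF assms(2)] assms(3)]
  by (intro norm_op_le_if_form_le) (simp_all add: form_of_def)


section \<open>Extension of positive functionals\<close>

definition sublinear :: "('v::real_vector \<Rightarrow> real) \<Rightarrow> bool" where
  "sublinear p \<longleftrightarrow> (\<forall>x y. p (x + y) \<le> p x + p y) \<and> (\<forall>r x. 0 \<le> r \<longrightarrow> p (r *\<^sub>R x) = r * p x)"

lemma sublinear_add: "sublinear p \<Longrightarrow> p (x + y) \<le> p x + p y"
  and sublinear_scale: "sublinear p \<Longrightarrow> 0 \<le> r \<Longrightarrow> p (r *\<^sub>R x) = r * p x"
  by (simp_all add: sublinear_def)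

lemma sublinear_zero: "sublinear p \<Longrightarrow> p 0 = 0"
  using sublinear_scale[of p 0 0] by simp

lemma sublinear_minus: "sublinear p \<Longrightarrow> - p (- x) \<le> p x"
  using sublinear_add[of p x "- x"] sublinear_zero[of p] by simp

lemma sublinearI_pos:
  assumes "\<And>x y. p (x + y) \<le> p x + p y" and "\<And>r x. 0 < r \<Longrightarrow> p (r *\<^sub>R x) \<le> r * p x" and "p 0 = 0"
  shows "sublinear p"
  unfolding sublinear_def
proof (intro conjI allI impI)
  fix r :: real and x
  assume "0 \<le> r"
  show "p (r *\<^sub>R x) = r * p x"
  proof (cases "r = 0")
    case False
    with \<open>0 \<le> r\<close> have r: "0 < r" by simp
    have "p (inverse r *\<^sub>R (r *\<^sub>R x)) \<le> inverse r * p (r *\<^sub>R x)"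
      using r by (intro assms(2)) simp
    then have "r * p x \<le> p (r *\<^sub>R x)" using r by (simp add: field_simps)
    with assms(2)[OF r, of x] show ?thesis by simp
  qed (simp add: assms(3))
qed (rule assms(1))

text \<open>The functional \<open>x \<mapsto> inf {q (x + t y) - t q y | t \<ge> 0}\<close> is sublinear and below \<open>q\<close>, hence equal to
  \<open>q\<close> by minimality. Its value at \<open>- y\<close> is at most \<open>- q y\<close>, so \<open>q\<close> is odd and therefore linear.\<close>

lemma minimal_sublinear_linear:
  fixes q :: "'v::real_vector \<Rightarrow> real"
  assumes q: "sublinear q" and min: "\<And>q'. sublinear q' \<Longrightarrow> (\<And>x. q' x \<le> q x) \<Longrightarrow> q' = q"
  shows "linear q"
proof -
  have minus: "q (- y) = - q y" for y
  proof -
    define q' where "q' x = (INF t\<in>{0..}. q (x + t *\<^sub>R y) - t * q y)" for x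
    have lower: "- q (- x) \<le> q (x + t *\<^sub>R y) - t * q y" if "0 \<le> t" for x t
      using sublinear_add[OF q, of "x + t *\<^sub>R y" "- x"] sublinear_scale[OF q that, of y] by simp
    have le: "q' x \<le> q (x + t *\<^sub>R y) - t * q y" if "0 \<le> t" for x t
      unfolding q'_def using that lower[of _ x]
      by (intro cINF_lower bdd_belowI2[where m = "- q (- x)"]) auto
    have greatest: "m \<le> q' x" if "\<And>t. 0 \<le> t \<Longrightarrow> m \<le> q (x + t *\<^sub>R y) - t * q y" for m x
      unfolding q'_def using that by (intro cINF_greatest) auto
    have "sublinear q'"
    proof (rule sublinearI_pos)
      fix x z
      have "q' (x + z) - (q (x + s *\<^sub>R y) - s * q y) \<le> q (z + t *\<^sub>R y) - t * q y"
        if "0 \<le> s" "0 \<le> t" for s t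
        using le[of "s + t" "x + z"] that sublinear_add[OF q, of "x + s *\<^sub>R y" "z + t *\<^sub>R y"]
        by (simp add: algebra_simps)
      then have "q' (x + z) - (q (x + s *\<^sub>R y) - s * q y) \<le> q' z" if "0 \<le> s" for s
        using that by (intro greatest)
      then have "q' (x + z) - q' z \<le> q' x"
        by (intro greatest) (simp add: algebra_simps)
      then show "q' (x + z) \<le> q' x + q' z" by simp
    next
      fix r x assume r: "0 < (r::real)"
      have "inverse r * q' (r *\<^sub>R x) \<le> q' x"
      proof (rule greatest)
        fix t :: real assume t: "0 \<le> t"
        have "q' (r *\<^sub>R x) \<le> q (r *\<^sub>R (x + t *\<^sub>R y)) - (r * t) * q y"
          using le[of "r * t" "r *\<^sub>R x"] r t by (simp add: scaleR_add_right)
        also have "q (r *\<^sub>R (x + t *\<^sub>R y)) = r * q (x + t *\<^sub>R y)"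
          using r by (intro sublinear_scale[OF q]) simp
        finally show "inverse r * q' (r *\<^sub>R x) \<le> q (x + t *\<^sub>R y) - t * q y"
          using r by (simp add: field_simps)
      qed
      then show "q' (r *\<^sub>R x) \<le> r * q' x" using r by (simp add: field_simps)
    next
      show "q' 0 = 0"
        using le[of 0 0] greatest[of 0 0]
        by (simp add: sublinear_zero[OF q] sublinear_scale[OF q])
    qed
    moreover have "q' x \<le> q x" for x using le[of 0 x] by simp
    ultimately have "q' = q" by (rule min)
    then have "q (- y) \<le> - q y" using le[of 1 "- y"] sublinear_zero[OF q] by simp
    with sublinear_minus[OF q, of y] show ?thesis by simp
  qed
  show ?thesis
  proof (rule linearI)
    show "q (x + y) = q x + q y" for x y
      using sublinear_add[OF q, of x y] sublinear_add[OF q, of "- x" "- y"] minus[of "x + y"]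
      by (simp add: minus)
    show "q (r *\<^sub>R x) = r *\<^sub>R q x" for r x
      using sublinear_scale[OF q, of r x] sublinear_scale[OF q, of "- r" x] minus[of "r *\<^sub>R x"]
      by (cases "0 \<le> r") simp_all
  qed
qed

text \<open>The Hahn-Banach theorem by Zorn's lemma: a lower bound of a chain of sublinear functionals below
  \<open>p\<close> is its pointwise infimum, which is finite since \<open>- p (- x) \<le> q x\<close> for each member \<open>q\<close>.\<close>

lemma sublinear_dominates_linear:
  fixes p :: "'v::real_vector \<Rightarrow> real"
  assumes p: "sublinear p"
  shows "\<exists>g. linear g \<and> (\<forall>x. g x \<le> p x)"
proof -
  define Q where "Q = {q. sublinear q \<and> q \<le> p}"
  have "\<exists>q\<in>Q. \<forall>q'\<in>Q. q' \<le> q \<longrightarrow> q' = q"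
  proof (rule predicate_Zorn)
    show "partial_order_on Q (relation_of (\<lambda>q q'. q' \<le> q) Q)"
      by (rule partial_order_on_relation_ofI) auto
    fix C assume "C \<in> Chains (relation_of (\<lambda>q q'. q' \<le> q) Q)"
    then have C: "C \<subseteq> Q" and chain: "\<And>q q'. q \<in> C \<Longrightarrow> q' \<in> C \<Longrightarrow> q \<le> q' \<or> q' \<le> q"
      by (auto simp: Chains_def relation_of_def)
    show "\<exists>u\<in>Q. \<forall>q\<in>C. u \<le> q"
    proof (cases "C = {}")
      case True
      then show ?thesis using p by (auto simp: Q_def)
    next
      case False
      define u where "u x = (INF q\<in>C. q x)" for x
      have lower: "- p (- x) \<le> q x" if "q \<in> C" for q x
      proof -
        have "sublinear q" "q (- x) \<le> p (- x)" using that C by (auto simp: Q_def le_fun_def)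
        with sublinear_minus[of q x] show ?thesis by simp
      qed
      have le: "u x \<le> q x" if "q \<in> C" for q x
        unfolding u_def using that lower by (intro cINF_lower bdd_belowI2) auto
      have greatest: "m \<le> u x" if "\<And>q. q \<in> C \<Longrightarrow> m \<le> q x" for m x
        unfolding u_def using that False by (intro cINF_greatest)
      have sub: "sublinear q" if "q \<in> C" for q using that C by (auto simp: Q_def)
      have "sublinear u"
      proof (rule sublinearI_pos)
        fix x y
        have "u (x + y) - q x \<le> q' y" if "q \<in> C" "q' \<in> C" for q q'
          using chain[OF that]
        proof
          assume "q \<le> q'"
          then have "q y \<le> q' y" by (rule le_funD)
          with le[OF that(1), of "x + y"] sublinear_add[OF sub[OF that(1)], of x y]
          show ?thesis by simp
        next
          assume "q' \<le> q"
          then have "q' x \<le> q x" by (rule le_funD)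
          with le[OF that(2), of "x + y"] sublinear_add[OF sub[OF that(2)], of x y]
          show ?thesis by simp
        qed
        then have "u (x + y) - q x \<le> u y" if "q \<in> C" for q
          using that by (intro greatest)
        then have "u (x + y) - u y \<le> u x"
          by (intro greatest) (simp add: algebra_simps)
        then show "u (x + y) \<le> u x + u y" by simp
      next
        fix r x assume r: "0 < (r::real)"
        have "inverse r * u (r *\<^sub>R x) \<le> u x"
        proof (rule greatest)
          fix q assume "q \<in> C"
          then have "u (r *\<^sub>R x) \<le> r * q x"
            using le[of q "r *\<^sub>R x"] sublinear_scale[OF sub, of q r x] r by simp
          then show "inverse r * u (r *\<^sub>R x) \<le> q x" using r by (simp add: field_simps)
        qed
        then show "u (r *\<^sub>R x) \<le> r * u x" using r by (simp add: field_simps)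
      next
        have "u 0 = (INF q\<in>C. 0)" unfolding u_def using sub sublinear_zero by (intro INF_cong) auto
        then show "u 0 = 0" using False by simp
      qed
      moreover have "u \<le> p"
      proof -
        obtain q where "q \<in> C" using False by blast
        then have "u \<le> q" "q \<le> p" using le C by (auto simp: Q_def le_fun_def)
        then show ?thesis by (rule order_trans)
      qed
      ultimately have "u \<in> Q" by (simp add: Q_def)
      then show ?thesis using le by (auto simp: le_fun_def)
    qed
  qed
  then obtain q where "q \<in> Q" and "\<And>q'. q' \<in> Q \<Longrightarrow> q' \<le> q \<Longrightarrow> q' = q" by blast
  then have "linear q"
    by (intro minimal_sublinear_linear) (auto simp: Q_def le_fun_def intro: order_trans)
  with \<open>q \<in> Q\<close> show ?thesis by (auto simp: Q_def le_fun_def)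
qed

text \<open>The extension theorem of M. Riesz. Since \<open>W\<close> is cofinal for the preorder defined by the cone
  \<open>P\<close>, the functional \<open>v \<mapsto> inf {f w | w \<in> W, w - v \<in> P}\<close> is finite; it is sublinear, and a linear
  functional below it extends \<open>f\<close> and is positive.\<close>

lemma riesz_extension:
  fixes f :: "'v::real_vector \<Rightarrow> real"
  assumes W: "subspace W"
    and f_add: "\<And>v w. v \<in> W \<Longrightarrow> w \<in> W \<Longrightarrow> f (v + w) = f v + f w"
    and f_scale: "\<And>r w. w \<in> W \<Longrightarrow> f (r *\<^sub>R w) = r * f w"
    and P_zero: "0 \<in> P" and P_add: "\<And>v w. v \<in> P \<Longrightarrow> w \<in> P \<Longrightarrow> v + w \<in> P"
    and P_scale: "\<And>r v. 0 \<le> r \<Longrightarrow> v \<in> P \<Longrightarrow> r *\<^sub>R v \<in> P"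
    and f_pos: "\<And>w. w \<in> W \<Longrightarrow> w \<in> P \<Longrightarrow> 0 \<le> f w"
    and cofinal: "\<And>v. \<exists>w\<in>W. w - v \<in> P"
  shows "\<exists>g. linear g \<and> (\<forall>w\<in>W. g w = f w) \<and> (\<forall>v\<in>P. 0 \<le> g v)"
proof -
  define U where "U v = {w \<in> W. w - v \<in> P}" for v
  define p where "p v = (INF w\<in>U v. f w)" for v
  have f0: "f 0 = 0" using f_scale[of 0 0] subspace_0[OF W] by simp
  have f_minus: "f (- w) = - f w" if "w \<in> W" for w
    using f_scale[OF that, of "- 1"] by simp
  have lower: "- f w' \<le> f w" if "w' \<in> U (- v)" "w \<in> U v" for v w w'
  proof -
    have "(w' - (- v)) + (w - v) \<in> P" using that P_add unfolding U_def by blast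
    then have "w + w' \<in> P" by (simp add: algebra_simps)
    then have "0 \<le> f (w + w')" using that W f_pos by (auto simp: U_def subspace_add)
    then show ?thesis using that f_add by (auto simp: U_def)
  qed
  have ne: "U v \<noteq> {}" for v using cofinal by (auto simp: U_def)
  have le: "p v \<le> f w" if "w \<in> U v" for v w
  proof -
    obtain w' where "w' \<in> U (- v)" using ne by blast
    then show ?thesis
      unfolding p_def using that lower by (intro cINF_lower bdd_belowI2[where m = "- f w'"])
  qed
  have greatest: "m \<le> p v" if "\<And>w. w \<in> U v \<Longrightarrow> m \<le> f w" for m v
    unfolding p_def using that ne by (intro cINF_greatest)
  have "sublinear p"
  proof (rule sublinearI_pos)
    fix v v'
    have "p (v + v') - f w \<le> f w'" if "w \<in> U v" "w' \<in> U v'" for w w'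
    proof -
      have "(w - v) + (w' - v') \<in> P" using that P_add unfolding U_def by blast
      then have "w + w' \<in> U (v + v')"
        using that W by (auto simp: U_def subspace_add algebra_simps)
      from le[OF this] show ?thesis using that f_add by (auto simp: U_def)
    qed
    then have "p (v + v') - f w \<le> p v'" if "w \<in> U v" for w
      using that by (intro greatest)
    then have "p (v + v') - p v' \<le> p v"
      by (intro greatest) (simp add: algebra_simps)
    then show "p (v + v') \<le> p v + p v'" by simp
  next
    fix r v assume r: "0 < (r::real)"
    have "inverse r * p (r *\<^sub>R v) \<le> p v"
    proof (rule greatest)
      fix w assume w: "w \<in> U v"
      have "r *\<^sub>R (w - v) \<in> P" using w r by (intro P_scale) (auto simp: U_def)
      then have "r *\<^sub>R w \<in> U (r *\<^sub>R v)"
        using w W by (auto simp: U_def subspace_scale scaleR_diff_right)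
      from le[OF this] show "inverse r * p (r *\<^sub>R v) \<le> f w"
        using w r f_scale by (simp add: U_def field_simps)
    qed
    then show "p (r *\<^sub>R v) \<le> r * p v" using r by (simp add: field_simps)
  next
    have "0 \<in> U 0" using P_zero W by (simp add: U_def subspace_0)
    then have "p 0 \<le> 0" using le f0 by fastforce
    moreover have "0 \<le> p 0" by (rule greatest) (simp add: U_def f_pos)
    ultimately show "p 0 = 0" by simp
  qed
  then obtain g where g: "linear g" and gp: "\<And>v. g v \<le> p v"
    using sublinear_dominates_linear by blast
  have g_le: "g w \<le> f w" if "w \<in> W" for w
    using gp[of w] le[of w w] that P_zero by (simp add: U_def)
  have "g w = f w" if "w \<in> W" for w
    using g_le[OF that] g_le[of "- w"] that W f_minus linear_neg[OF g, of w]
    by (simp add: subspace_neg)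
  moreover have "0 \<le> g v" if "v \<in> P" for v
  proof -
    have "0 \<in> U (- v)" using that W by (simp add: U_def subspace_0)
    from order_trans[OF gp le[OF this]] show ?thesis by (simp add: f0 linear_neg[OF g])
  qed
  ultimately show ?thesis using g by blast
qed


section \<open>Extension of completely positive maps\<close>

instantiation poly_mapping :: (type, real_vector) real_vector
begin

lift_definition scaleR_poly_mapping :: "real \<Rightarrow> ('a \<Rightarrow>\<^sub>0 'b) \<Rightarrow> 'a \<Rightarrow>\<^sub>0 'b" is "\<lambda>r v k. r *\<^sub>R v k"
  by (rule finite_subset[rotated]) auto

instance
  by standard (transfer; simp add: fun_eq_iff algebra_simps)+

end

instantiation poly_mapping :: (type, complex_vector) complex_vector
begin

lift_definition scaleC_poly_mapping :: "complex \<Rightarrow> ('a \<Rightarrow>\<^sub>0 'b) \<Rightarrow> 'a \<Rightarrow>\<^sub>0 'b" is "\<lambda>c v k. c *\<^sub>C v k"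
  by (rule finite_subset[rotated]) (auto simp: complex_vector.scale_zero_right)

instance
  by standard (transfer; simp add: fun_eq_iff scaleC_add_left scaleC_add_right scaleC_scaleC
      scaleC_one scaleR_scaleC)+

end

lemma lookup_scaleC: "Poly_Mapping.lookup (c *\<^sub>C v) k = c *\<^sub>C Poly_Mapping.lookup v k"
  by transfer simp

text \<open>A finitely supported matrix of operators, indexed by vectors of the Hilbert space. The vectors
  serve as names of rows and columns; \<open>\<xi>\<close> turns the names into the entries of a column vector.\<close>

type_synonym 'h op_matrix = "'h \<times> 'h \<Rightarrow>\<^sub>0 'h bop"

definition matrices_over :: "'h::complex_hilbert_space bop set \<Rightarrow> 'h op_matrix set" where
  "matrices_over D = {v. \<forall>k. Poly_Mapping.lookup v k \<in> D}"

definition matrix_form :: "('h::complex_hilbert_space bop \<Rightarrow> 'h bop) \<Rightarrow> ('h \<Rightarrow> 'h) \<Rightarrow> 'h op_matrix \<Rightarrow> complex" where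
  "matrix_form \<phi> \<xi> v = (\<Sum>k\<in>Poly_Mapping.keys v. form_of \<phi> (Poly_Mapping.lookup v k) (\<xi> (snd k)) (\<xi> (fst k)))"

lemma form_of_add:
  "linear_map_on D \<phi> \<Longrightarrow> a \<in> D \<Longrightarrow> b \<in> D \<Longrightarrow> form_of \<phi> (a + b) x y = form_of \<phi> a x y + form_of \<phi> b x y"
  by (simp add: form_of_def linear_map_on_def op_apply_add cinner_add_left)

lemma form_of_scaleC:
  "linear_map_on D \<phi> \<Longrightarrow> a \<in> D \<Longrightarrow> form_of \<phi> (c *\<^sub>C a) x y = c * form_of \<phi> a x y"
  by (simp add: form_of_def linear_map_on_def op_apply_scaleC_op cinner_scaleC_left)

lemma form_of_zero:
  assumes "csubspace D" "linear_map_on D \<phi>"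
  shows "form_of \<phi> 0 x y = 0"
  using form_of_scaleC[OF assms(2), of 0 0] complex_vector.subspace_0[OF assms(1)]
  by (simp add: complex_vector.scale_zero_left)

lemma csubspace_matrices_over: "csubspace D \<Longrightarrow> csubspace (matrices_over D)"
  by (simp add: complex_vector.subspace_def matrices_over_def lookup_add lookup_scaleC)

lemma matrix_form_superset:
  assumes "csubspace D" "linear_map_on D \<phi>" "finite X" "Poly_Mapping.keys v \<subseteq> X"
  shows "matrix_form \<phi> \<xi> v = (\<Sum>k\<in>X. form_of \<phi> (Poly_Mapping.lookup v k) (\<xi> (snd k)) (\<xi> (fst k)))"
  unfolding matrix_form_def using assms
  by (intro sum.mono_neutral_left) (auto simp: in_keys_iff form_of_zero[of D \<phi>])

lemma matrix_form_add:
  assumes D: "csubspace D" "linear_map_on D \<phi>" and "v \<in> matrices_over D" "w \<in> matrices_over D"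
  shows "matrix_form \<phi> \<xi> (v + w) = matrix_form \<phi> \<xi> v + matrix_form \<phi> \<xi> w"
proof -
  let ?X = "Poly_Mapping.keys v \<union> Poly_Mapping.keys w"
  have X: "finite ?X" "Poly_Mapping.keys (v + w) \<subseteq> ?X" by (simp_all add: Poly_Mapping.keys_add)
  have "Poly_Mapping.lookup v k \<in> D" "Poly_Mapping.lookup w k \<in> D" for k
    using assms by (simp_all only: matrices_over_def mem_Collect_eq)
  then show ?thesis
    by (simp add: matrix_form_superset[OF D X] matrix_form_superset[OF D X(1), of v]
        matrix_form_superset[OF D X(1), of w] lookup_add form_of_add[OF D(2)] sum.distrib)
qed

lemma matrix_form_scaleC:
  assumes D: "csubspace D" "linear_map_on D \<phi>" and "v \<in> matrices_over D"
  shows "matrix_form \<phi> \<xi> (c *\<^sub>C v) = c * matrix_form \<phi> \<xi> v"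
proof -
  have X: "Poly_Mapping.keys (c *\<^sub>C v) \<subseteq> Poly_Mapping.keys v"
    by (auto simp: in_keys_iff lookup_scaleC complex_vector.scale_zero_right)
  have "Poly_Mapping.lookup v k \<in> D" for k
    using assms by (simp only: matrices_over_def mem_Collect_eq)
  then have "(\<Sum>k\<in>Poly_Mapping.keys v. form_of \<phi> (Poly_Mapping.lookup (c *\<^sub>C v) k) (\<xi> (snd k)) (\<xi> (fst k)))
      = c * matrix_form \<phi> \<xi> v"
    by (simp add: matrix_form_def lookup_scaleC form_of_scaleC[OF D(2)] sum_distrib_left)
  then show ?thesis
    using matrix_form_superset[OF D finite_keys X] by simp
qed

lemma matrix_form_sum:
  assumes D: "csubspace D" "linear_map_on D \<phi>" and "\<And>i. i \<in> I \<Longrightarrow> v i \<in> matrices_over D"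
  shows "matrix_form \<phi> \<xi> (\<Sum>i\<in>I. v i) = (\<Sum>i\<in>I. matrix_form \<phi> \<xi> (v i))"
proof (cases "finite I")
  case True
  then show ?thesis using assms(3)
  proof (induction I)
    case (insert i I)
    moreover have "(\<Sum>i\<in>I. v i) \<in> matrices_over D"
      using insert.prems D by (intro complex_vector.subspace_sum csubspace_matrices_over) auto
    ultimately show ?case by (simp add: matrix_form_add[OF D])
  qed (simp add: matrix_form_def)
qed (simp add: matrix_form_def)

lemma linear_map_on_ident: "linear_map_on D (\<lambda>a. a)"
  by (simp add: linear_map_on_def)

lemma ucp_on_ident: "ucp_on D (\<lambda>a. a)"
  by (simp add: ucp_on_def completely_positive_on_def linear_map_on_ident)

text \<open>The enumeration \<open>e\<close> of the rows and columns of \<open>v\<close> turns \<open>v + v\<^sup>*\<close> into a matrix to which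
  complete positivity applies. Passing to \<open>v + v\<^sup>*\<close> is what makes a condition on the real part of the
  form of \<open>v\<close> a positivity condition.\<close>

lemma matrix_form_real_part:
  fixes n :: nat
  assumes D: "operator_system D" and \<phi>: "ucp_on D \<phi>" and v: "v \<in> matrices_over D"
    and e: "bij_betw e {..<n} X" and X: "Poly_Mapping.keys v \<subseteq> X \<times> X"
  shows "(\<Sum>i<n. \<Sum>j<n. form_of \<phi> (Poly_Mapping.lookup v (e i, e j) + adj (Poly_Mapping.lookup v (e j, e i))) (\<xi> (e j)) (\<xi> (e i)))
    = matrix_form \<phi> \<xi> v + cnj (matrix_form \<phi> \<xi> v)"
proof -
  have lin: "csubspace D" "linear_map_on D \<phi>"
    using D \<phi> by (auto simp: operator_system_def ucp_on_def completely_positive_on_def)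
  have "finite X" using bij_betw_finite[OF e] by simp
  then have "matrix_form \<phi> \<xi> v = (\<Sum>p\<in>X. \<Sum>q\<in>X. form_of \<phi> (Poly_Mapping.lookup v (p, q)) (\<xi> q) (\<xi> p))"
    using matrix_form_superset[OF lin _ X] by (simp add: sum.cartesian_product case_prod_beta)
  also have "\<dots> = (\<Sum>i<n. \<Sum>j<n. form_of \<phi> (Poly_Mapping.lookup v (e i, e j)) (\<xi> (e j)) (\<xi> (e i)))"
    by (simp add: sum.reindex_bij_betw[OF e, symmetric])
  finally have eq: "matrix_form \<phi> \<xi> v = (\<Sum>i<n. \<Sum>j<n. form_of \<phi> (Poly_Mapping.lookup v (e i, e j)) (\<xi> (e j)) (\<xi> (e i)))" .
  have vD: "Poly_Mapping.lookup v k \<in> D" "adj (Poly_Mapping.lookup v k) \<in> D" for k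
    using v D by (cases k; simp add: matrices_over_def operator_system_def)+
  have "form_of \<phi> (Poly_Mapping.lookup v (e i, e j) + adj (Poly_Mapping.lookup v (e j, e i))) (\<xi> (e j)) (\<xi> (e i))
      = form_of \<phi> (Poly_Mapping.lookup v (e i, e j)) (\<xi> (e j)) (\<xi> (e i))
        + cnj (form_of \<phi> (Poly_Mapping.lookup v (e j, e i)) (\<xi> (e i)) (\<xi> (e j)))" for i j
    using vD ucp_form_adj[OF D ucp_form_form_of[OF \<phi>]] by (simp add: form_of_add[OF lin(2)])
  then show ?thesis
    by (simp add: sum.distrib eq)
      (subst sum.swap, simp)
qed

lemma matrix_form_positive:
  assumes D: "operator_system D" and \<phi>: "ucp_on D \<phi>" and v: "v \<in> matrices_over D"
    and pos: "\<And>\<xi>. 0 \<le> Re (matrix_form (\<lambda>a. a) \<xi> v)"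
  shows "0 \<le> Re (matrix_form \<phi> \<xi> v)"
proof -
  define X where "X = fst ` Poly_Mapping.keys v \<union> snd ` Poly_Mapping.keys v"
  have "finite X" by (simp add: X_def)
  then obtain e where "bij_betw e {0..<card X} X"
    using ex_bij_betw_nat_finite by blast
  then obtain n where e: "bij_betw e {..<n} X" by (metis atLeast0LessThan)
  have X: "Poly_Mapping.keys v \<subseteq> X \<times> X" by (force simp: X_def)
  note real_part = matrix_form_real_part[OF D _ v e X]
  let ?a = "\<lambda>i j. Poly_Mapping.lookup v (e i, e j) + adj (Poly_Mapping.lookup v (e j, e i))"
  have "pos_matrix n ?a"
    unfolding pos_matrix_iff
  proof
    fix \<eta> :: "nat \<Rightarrow> 'a"
    let ?\<xi> = "\<lambda>x. \<eta> (the_inv_into {..<n} e x)"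
    have "?\<xi> (e i) = \<eta> i" if "i < n" for i
      using that e by (simp add: the_inv_into_f_f bij_betw_def)
    then have "(\<Sum>i<n. \<Sum>j<n. cinner (op_apply (?a i j) (\<eta> j)) (\<eta> i))
        = matrix_form (\<lambda>a. a) ?\<xi> v + cnj (matrix_form (\<lambda>a. a) ?\<xi> v)"
      using real_part[OF ucp_on_ident, of ?\<xi>] by (simp add: form_of_def)
    then show "(\<Sum>i<n. \<Sum>j<n. cinner (op_apply (?a i j) (\<eta> j)) (\<eta> i)) \<in> \<real>\<^sub>\<ge>\<^sub>0"
      using pos[of ?\<xi>] by (simp add: complex_nonneg_Reals_iff)
  qed
  moreover have "?a i j \<in> D" for i j
    using D v by (simp add: operator_system_def matrices_over_def complex_vector.subspace_add)
  ultimately have "(\<Sum>i<n. \<Sum>j<n. form_of \<phi> (?a i j) (\<xi> (e j)) (\<xi> (e i))) \<in> \<real>\<^sub>\<ge>\<^sub>0"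
    by (intro ucp_form_pos[OF ucp_form_form_of[OF \<phi>], where \<xi> = "\<lambda>i. \<xi> (e i)"]) auto
  then show ?thesis
    unfolding real_part[OF \<phi>] by (simp add: complex_nonneg_Reals_iff)
qed

lemma cmod_matrix_form_le:
  assumes "finite X" "Poly_Mapping.keys v \<subseteq> X \<times> X"
  shows "cmod (matrix_form (\<lambda>a. a) \<xi> v) \<le> (\<Sum>k\<in>Poly_Mapping.keys v. norm (Poly_Mapping.lookup v k)) * (\<Sum>x\<in>X. (norm (\<xi> x))\<^sup>2)"
proof -
  have "cmod (form_of (\<lambda>a. a) (Poly_Mapping.lookup v k) (\<xi> (snd k)) (\<xi> (fst k)))
      \<le> norm (Poly_Mapping.lookup v k) * (\<Sum>x\<in>X. (norm (\<xi> x))\<^sup>2)" if "k \<in> Poly_Mapping.keys v" for k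
  proof -
    let ?x = "\<xi> (snd k)" and ?y = "\<xi> (fst k)"
    have le: "(norm (\<xi> x))\<^sup>2 \<le> (\<Sum>x\<in>X. (norm (\<xi> x))\<^sup>2)" if "x \<in> X" for x
      using that assms(1) by (intro member_le_sum) auto
    have "snd k \<in> X" "fst k \<in> X" using that assms(2) by auto
    then have "norm ?x * norm ?y \<le> (\<Sum>x\<in>X. (norm (\<xi> x))\<^sup>2)"
      using le[of "snd k"] le[of "fst k"] sum_squares_bound[of "norm ?x" "norm ?y"] by simp
    then have "norm (Poly_Mapping.lookup v k) * (norm ?x * norm ?y)
        \<le> norm (Poly_Mapping.lookup v k) * (\<Sum>x\<in>X. (norm (\<xi> x))\<^sup>2)"
      by (intro mult_left_mono) simp_all
    moreover have "cmod (form_of (\<lambda>a. a) (Poly_Mapping.lookup v k) ?x ?y) \<le> norm (Poly_Mapping.lookup v k) * (norm ?x * norm ?y)"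
      using order_trans[OF Cauchy_Schwarz_cinner mult_right_mono[OF norm_op_apply_le norm_ge_zero],
          of "Poly_Mapping.lookup v k" ?x ?y] by (simp add: form_of_def mult_ac)
    ultimately show ?thesis by linarith
  qed
  then show ?thesis
    unfolding matrix_form_def sum_distrib_right by (intro sum_norm_le) simp
qed

text \<open>The witness is a multiple of the identity matrix on the rows and columns of \<open>v\<close>; the factor is
  the sum of the norms of the entries of \<open>v\<close>.\<close>

lemma matrices_cofinal:
  fixes v :: "'h::complex_hilbert_space op_matrix"
  assumes D: "operator_system D"
  shows "\<exists>w\<in>matrices_over D. \<forall>\<xi>. 0 \<le> Re (matrix_form (\<lambda>a. a) \<xi> (w - v))"
proof -
  define X where "X = fst ` Poly_Mapping.keys v \<union> snd ` Poly_Mapping.keys v"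
  have fin: "finite X" by (simp add: X_def)
  have sub: "Poly_Mapping.keys v \<subseteq> X \<times> X" by (force simp: X_def)
  define K where "K = (\<Sum>k\<in>Poly_Mapping.keys v. norm (Poly_Mapping.lookup v k))"
  define w :: "'h op_matrix" where
    "w = (\<Sum>x\<in>X. Poly_Mapping.single (x, x) (complex_of_real K *\<^sub>C 1))"
  note lin = complex_vector.subspace_UNIV linear_map_on_ident
  have all: "u \<in> matrices_over UNIV" for u :: "'h op_matrix" by (simp add: matrices_over_def)
  have single: "Poly_Mapping.single (x, x) (complex_of_real K *\<^sub>C 1) \<in> matrices_over D" for x :: 'h
    using D by (auto simp: matrices_over_def lookup_single when_def operator_system_def
        complex_vector.subspace_scale complex_vector.subspace_0)
  have "matrix_form (\<lambda>a. a) \<xi> (Poly_Mapping.single (x, x) (complex_of_real K *\<^sub>C 1))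
      = complex_of_real (K * (norm (\<xi> x))\<^sup>2)" for \<xi> and x :: 'h
    using matrix_form_superset[OF lin, of "{(x, x)}" "Poly_Mapping.single (x, x) (complex_of_real K *\<^sub>C 1)" \<xi>]
    by (simp add: form_of_def op_apply_scaleC_op cinner_scaleC_left cinner_self)
  then have "matrix_form (\<lambda>a. a) \<xi> w = complex_of_real (K * (\<Sum>x\<in>X. (norm (\<xi> x))\<^sup>2))" for \<xi>
    unfolding w_def by (simp add: matrix_form_sum[OF lin] all sum_distrib_left)
  moreover have "matrix_form (\<lambda>a. a) \<xi> (w - v) = matrix_form (\<lambda>a. a) \<xi> w - matrix_form (\<lambda>a. a) \<xi> v" for \<xi>
    using matrix_form_add[OF lin all all, of \<xi> "w - v" v] by simp
  moreover have "w \<in> matrices_over D"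
    unfolding w_def using D
    by (intro complex_vector.subspace_sum csubspace_matrices_over single) (simp add: operator_system_def)
  ultimately show ?thesis
    using order_trans[OF complex_Re_le_cmod cmod_matrix_form_le[OF fin sub]]
    by (intro bexI[of _ w]) (simp_all add: K_def)
qed

text \<open>The Riesz theorem is applied to the real part of \<open>matrix_form \<phi>\<close> and to the cone of matrices
  with positive real part. On matrices with positive form the complexification of the extension is
  positive, because such a matrix times \<open>\<i>\<close> and its negative both lie in the cone.\<close>

lemma matrix_functional_extension:
  assumes D: "operator_system D" and \<phi>: "ucp_on D \<phi>"
  shows "\<exists>F :: 'h::complex_hilbert_space op_matrix \<Rightarrow> complex.
     (\<forall>v w. F (v + w) = F v + F w) \<and> (\<forall>c v. F (c *\<^sub>C v) = c * F v) \<and>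
     (\<forall>v\<in>matrices_over D. F v = matrix_form \<phi> (\<lambda>x. x) v) \<and>
     (\<forall>v. (\<forall>\<xi>. matrix_form (\<lambda>a. a) \<xi> v \<in> \<real>\<^sub>\<ge>\<^sub>0) \<longrightarrow> F v \<in> \<real>\<^sub>\<ge>\<^sub>0)"
proof -
  note UNIV = complex_vector.subspace_UNIV linear_map_on_ident
  have lin: "csubspace D" "linear_map_on D \<phi>"
    using D \<phi> by (auto simp: operator_system_def ucp_on_def completely_positive_on_def)
  have all: "u \<in> matrices_over UNIV" for u :: "'h op_matrix" by (simp add: matrices_over_def)
  note W = csubspace_matrices_over[OF lin(1)]
  define P :: "'h op_matrix set" where "P = {v. \<forall>\<xi>. 0 \<le> Re (matrix_form (\<lambda>a. a) \<xi> v)}"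
  have "\<exists>g. linear g \<and> (\<forall>w\<in>matrices_over D. g w = Re (matrix_form \<phi> (\<lambda>x. x) w)) \<and> (\<forall>v\<in>P. 0 \<le> g v)"
  proof (rule riesz_extension)
    show "subspace (matrices_over D)"
      using W by (simp add: subspace_def complex_vector.subspace_def scaleR_scaleC)
    show "Re (matrix_form \<phi> (\<lambda>x. x) (v + w)) = Re (matrix_form \<phi> (\<lambda>x. x) v) + Re (matrix_form \<phi> (\<lambda>x. x) w)"
      if "v \<in> matrices_over D" "w \<in> matrices_over D" for v w
      using that by (simp add: matrix_form_add[OF lin])
    show "Re (matrix_form \<phi> (\<lambda>x. x) (r *\<^sub>R w)) = r * Re (matrix_form \<phi> (\<lambda>x. x) w)"
      if "w \<in> matrices_over D" for r w
      using that by (simp add: scaleR_scaleC matrix_form_scaleC[OF lin])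
    show "0 \<in> P" by (simp add: P_def matrix_form_def)
    show "v + w \<in> P" if "v \<in> P" "w \<in> P" for v w
      using that by (simp add: P_def matrix_form_add[OF UNIV all all])
    show "r *\<^sub>R v \<in> P" if "0 \<le> r" "v \<in> P" for r v
      using that by (simp add: P_def scaleR_scaleC matrix_form_scaleC[OF UNIV all])
    show "0 \<le> Re (matrix_form \<phi> (\<lambda>x. x) w)" if "w \<in> matrices_over D" "w \<in> P" for w
      using that matrix_form_positive[OF D \<phi>] by (simp add: P_def)
    show "\<exists>w\<in>matrices_over D. w - v \<in> P" for v
      using matrices_cofinal[OF D, of v] by (simp add: P_def)
  qed
  then obtain g where g: "linear g"
    and g_ext: "\<And>w. w \<in> matrices_over D \<Longrightarrow> g w = Re (matrix_form \<phi> (\<lambda>x. x) w)"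
    and g_pos: "\<And>v. v \<in> P \<Longrightarrow> 0 \<le> g v"
    by blast
  define F where "F v = Complex (g v) (- g (\<i> *\<^sub>C v))" for v
  have split: "c *\<^sub>C v = Re c *\<^sub>R v + Im c *\<^sub>R (\<i> *\<^sub>C v)" for c and v :: "'h op_matrix"
  proof -
    have "c = complex_of_real (Re c) + complex_of_real (Im c) * \<i>" by (simp add: complex_eq_iff)
    then show ?thesis
      by (metis scaleC_add_left scaleC_scaleC scaleR_scaleC)
  qed
  have "F (v + w) = F v + F w" for v w
    by (simp add: F_def scaleC_add_right linear_add[OF g] complex_eq_iff)
  moreover have "F (c *\<^sub>C v) = c * F v" for c v
  proof -
    have "g (d *\<^sub>C v) = Re d * g v + Im d * g (\<i> *\<^sub>C v)" for d
      by (subst split) (simp add: linear_add[OF g] linear_scale[OF g])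
    from this[of c] this[of "\<i> * c"] show ?thesis
      by (simp add: F_def scaleC_scaleC complex_eq_iff algebra_simps)
  qed
  moreover have "F v = matrix_form \<phi> (\<lambda>x. x) v" if "v \<in> matrices_over D" for v
    using that complex_vector.subspace_scale[OF W that]
    by (simp add: F_def g_ext matrix_form_scaleC[OF lin] complex_eq_iff)
  moreover have "F v \<in> \<real>\<^sub>\<ge>\<^sub>0" if v: "\<forall>\<xi>. matrix_form (\<lambda>a. a) \<xi> v \<in> \<real>\<^sub>\<ge>\<^sub>0" for v
  proof -
    have "v \<in> P" "\<i> *\<^sub>C v \<in> P" "(- \<i>) *\<^sub>C v \<in> P"
      using v by (simp_all add: P_def complex_nonneg_Reals_iff matrix_form_scaleC[OF UNIV all]
          del: complex_vector.scale_minus_left)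
    then have "0 \<le> g v" "0 \<le> g (\<i> *\<^sub>C v)" "0 \<le> g (- (\<i> *\<^sub>C v))"
      using g_pos by (simp_all add: complex_vector.scale_minus_left)
    then show ?thesis by (simp add: F_def complex_nonneg_Reals_iff linear_neg[OF g])
  qed
  ultimately show ?thesis by blast
qed

text \<open>For a Hamel basis \<open>B\<close> this is the tensor product of \<open>a\<close> with the rank one matrix of the
  coordinates of \<open>x\<close> and the conjugate coordinates of \<open>y\<close>. A functional on matrices composed with
  it becomes sesquilinear in \<open>x\<close> and \<open>y\<close>.\<close>

definition coordinate_matrix ::
    "'h::complex_hilbert_space set \<Rightarrow> 'h bop \<Rightarrow> 'h \<Rightarrow> 'h \<Rightarrow> 'h op_matrix" where
  "coordinate_matrix B a x y = Abs_poly_mapping (\<lambda>(p, q).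
     (complex_vector.representation B x q * cnj (complex_vector.representation B y p)) *\<^sub>C a)"

text \<open>The linear extension of \<open>\<xi>\<close> from the basis \<open>B\<close> to the whole space.\<close>

definition recombine :: "'h::complex_hilbert_space set \<Rightarrow> ('h \<Rightarrow> 'h) \<Rightarrow> 'h \<Rightarrow> 'h" where
  "recombine B \<xi> x = (\<Sum>b | complex_vector.representation B x b \<noteq> 0. complex_vector.representation B x b *\<^sub>C \<xi> b)"

lemma lookup_coordinate_matrix:
  "Poly_Mapping.lookup (coordinate_matrix B a x y) (p, q)
    = (complex_vector.representation B x q * cnj (complex_vector.representation B y p)) *\<^sub>C a"
proof -
  let ?r = "complex_vector.representation B"
  let ?f = "\<lambda>(p, q). (?r x q * cnj (?r y p)) *\<^sub>C a"
  have "finite ({p. ?r y p \<noteq> 0} \<times> {q. ?r x q \<noteq> 0})"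
    by (intro finite_cartesian_product complex_vector.finite_representation)
  then have "finite {k. ?f k \<noteq> 0}"
    by (rule finite_subset[rotated]) (auto simp: complex_vector.scale_zero_left)
  then show ?thesis by (simp add: coordinate_matrix_def)
qed

lemma coordinate_matrix_in:
  "csubspace D \<Longrightarrow> a \<in> D \<Longrightarrow> coordinate_matrix B a x y \<in> matrices_over D"
  by (simp add: matrices_over_def lookup_coordinate_matrix complex_vector.subspace_scale)

lemma matrix_form_coordinate_matrix:
  assumes D: "csubspace D" "linear_map_on D \<phi>" and a: "a \<in> D"
  shows "matrix_form \<phi> \<xi> (coordinate_matrix B a x y) = form_of \<phi> a (recombine B \<xi> x) (recombine B \<xi> y)"
proof -
  let ?r = "complex_vector.representation B"
  let ?X = "{p. ?r y p \<noteq> 0}" and ?Y = "{q. ?r x q \<noteq> 0}"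
  have "matrix_form \<phi> \<xi> (coordinate_matrix B a x y)
      = (\<Sum>k\<in>?X \<times> ?Y. form_of \<phi> (Poly_Mapping.lookup (coordinate_matrix B a x y) k) (\<xi> (snd k)) (\<xi> (fst k)))"
    by (intro matrix_form_superset[OF D] finite_cartesian_product complex_vector.finite_representation)
      (auto simp: in_keys_iff lookup_coordinate_matrix complex_vector.scale_zero_left)
  also have "\<dots> = (\<Sum>p\<in>?X. \<Sum>q\<in>?Y. ?r x q * (cnj (?r y p) * form_of \<phi> a (\<xi> q) (\<xi> p)))"
    unfolding sum.cartesian_product
    by (intro sum.cong) (auto simp: lookup_coordinate_matrix form_of_scaleC[OF D(2) a])
  also have "\<dots> = form_of \<phi> a (recombine B \<xi> x) (recombine B \<xi> y)"
    by (simp add: form_of_def recombine_def op_apply_sum_arg cinner_sum_left cinner_sum_right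
        op_apply_scaleC cinner_scaleC_left cinner_scaleC_right sum_distrib_left mult.left_commute)
  finally show ?thesis .
qed

text \<open>Arveson's extension theorem. The functional of \<open>matrix_functional_extension\<close> evaluated on
  coordinate matrices is a form on all operators that extends the form of \<open>\<phi>\<close>. It is positive because
  for a positive matrix \<open>a\<close> of operators the sum of the coordinate matrices of the \<open>a i j\<close> at the
  vectors \<open>\<xi> j\<close> and \<open>\<xi> i\<close> has a positive form.\<close>

lemma arveson_extension:
  fixes \<phi> :: "'h::complex_hilbert_space bop \<Rightarrow> 'h bop"
  assumes D: "operator_system D" and \<phi>: "ucp_on D \<phi>"
  shows "\<exists>\<psi>. ucp_on UNIV \<psi> \<and> (\<forall>a\<in>D. \<psi> a = \<phi> a)"
proof -
  note UNIV = complex_vector.subspace_UNIV linear_map_on_ident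
  have lin: "csubspace D" "linear_map_on D \<phi>" and one: "1 \<in> D" "\<phi> 1 = 1"
    using D \<phi> by (auto simp: operator_system_def ucp_on_def completely_positive_on_def)
  obtain B :: "'h set" where B: "complex_vector.independent B" "complex_vector.span B = UNIV"
    by (rule complex_vector.basis_exists[of UNIV]) (auto simp: top.extremum_unique)
  obtain F :: "'h op_matrix \<Rightarrow> complex" where F_add: "\<And>v w. F (v + w) = F v + F w"
    and F_scale: "\<And>c v. F (c *\<^sub>C v) = c * F v"
    and F_ext: "\<And>v. v \<in> matrices_over D \<Longrightarrow> F v = matrix_form \<phi> (\<lambda>x. x) v"
    and F_pos: "\<And>v. (\<And>\<xi>. matrix_form (\<lambda>a. a) \<xi> v \<in> \<real>\<^sub>\<ge>\<^sub>0) \<Longrightarrow> F v \<in> \<real>\<^sub>\<ge>\<^sub>0"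
    using matrix_functional_extension[OF assms] by metis
  have F_sum: "F (\<Sum>i\<in>I. v i) = (\<Sum>i\<in>I. F (v i))" for I :: "nat set" and v
    using F_scale[of 0 0] by (induction I rule: infinite_finite_induct)
      (simp_all add: F_add complex_vector.scale_zero_left)
  define G where "G a x y = F (coordinate_matrix B a x y)" for a x y
  have "recombine B (\<lambda>x. x) x = x" for x
    unfolding recombine_def by (rule complex_vector.sum_nonzero_representation_eq) (simp_all add: B)
  then have G_ext: "G a x y = form_of \<phi> a x y" if "a \<in> D" for a x y
    unfolding G_def using that lin
    by (simp add: F_ext coordinate_matrix_in matrix_form_coordinate_matrix[OF lin])
  have "ucp_form UNIV G"
    unfolding ucp_form_def
  proof (intro conjI ballI allI impI)
    fix a b x x' y y' and c :: complex
    note rep = complex_vector.representation_add[OF B(1)] complex_vector.representation_scale[OF B(1)]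
      lookup_add lookup_scaleC lookup_coordinate_matrix B(2)
    have "coordinate_matrix B (a + b) x y = coordinate_matrix B a x y + coordinate_matrix B b x y"
      by (rule poly_mapping_eqI) (auto simp: rep scaleC_add_right)
    then show "G (a + b) x y = G a x y + G b x y" by (simp add: G_def F_add)
    have "coordinate_matrix B (c *\<^sub>C a) x y = c *\<^sub>C coordinate_matrix B a x y"
      by (rule poly_mapping_eqI) (auto simp: rep scaleC_scaleC mult_ac)
    then show "G (c *\<^sub>C a) x y = c * G a x y" by (simp add: G_def F_scale)
    have "coordinate_matrix B a (x + x') y = coordinate_matrix B a x y + coordinate_matrix B a x' y"
      by (rule poly_mapping_eqI) (auto simp: rep distrib_right scaleC_add_left)
    then show "G a (x + x') y = G a x y + G a x' y" by (simp add: G_def F_add)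
    have "coordinate_matrix B a (c *\<^sub>C x) y = c *\<^sub>C coordinate_matrix B a x y"
      by (rule poly_mapping_eqI) (auto simp: rep scaleC_scaleC mult_ac)
    then show "G a (c *\<^sub>C x) y = c * G a x y" by (simp add: G_def F_scale)
    have "coordinate_matrix B a x (y + y') = coordinate_matrix B a x y + coordinate_matrix B a x y'"
      by (rule poly_mapping_eqI) (auto simp: rep distrib_left scaleC_add_left)
    then show "G a x (y + y') = G a x y + G a x y'" by (simp add: G_def F_add)
    have "coordinate_matrix B a x (c *\<^sub>C y) = cnj c *\<^sub>C coordinate_matrix B a x y"
      by (rule poly_mapping_eqI) (auto simp: rep scaleC_scaleC mult_ac)
    then show "G a x (c *\<^sub>C y) = cnj c * G a x y" by (simp add: G_def F_scale)
  next
    fix n and a :: "nat \<Rightarrow> nat \<Rightarrow> 'h bop" and \<xi> :: "nat \<Rightarrow> 'h"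
    assume a: "(\<forall>i<n. \<forall>j<n. a i j \<in> UNIV) \<and> pos_matrix n a"
    let ?v = "\<Sum>i<n. \<Sum>j<n. coordinate_matrix B (a i j) (\<xi> j) (\<xi> i)"
    have "matrix_form (\<lambda>a. a) \<eta> ?v
        = (\<Sum>i<n. \<Sum>j<n. cinner (op_apply (a i j) (recombine B \<eta> (\<xi> j))) (recombine B \<eta> (\<xi> i)))" for \<eta>
      by (simp add: matrix_form_sum[OF UNIV] matrix_form_coordinate_matrix[OF UNIV] matrices_over_def
          form_of_def)
    then have "F ?v \<in> \<real>\<^sub>\<ge>\<^sub>0"
      using a by (intro F_pos) (simp add: pos_matrix_iff)
    then show "(\<Sum>i<n. \<Sum>j<n. G (a i j) (\<xi> j) (\<xi> i)) \<in> \<real>\<^sub>\<ge>\<^sub>0"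
      by (simp add: F_sum G_def)
  next
    show "G 1 x y = cinner x y" for x y
      by (simp add: G_ext one form_of_def)
  qed
  then obtain \<psi> where \<psi>: "ucp_on UNIV \<psi>" "G = form_of \<psi>"
    using ucp_form_imp_ucp by blast
  have "\<psi> a = \<phi> a" if "a \<in> D" for a
    using G_ext[OF that] by (intro bop_eqI_form) (simp add: \<psi> form_of_def)
  with \<psi> show ?thesis by blast
qed


section \<open>The compact semigroup of maps fixing the operator system\<close>

lemma ucp_linear:
  assumes "ucp_on UNIV \<phi>"
  shows "\<phi> (a + b) = \<phi> a + \<phi> b" and "\<phi> (c *\<^sub>C a) = c *\<^sub>C \<phi> a" and "\<phi> 0 = 0"
    and "\<phi> (a - b) = \<phi> a - \<phi> b"
proof -
  show add: "\<phi> (a + b) = \<phi> a + \<phi> b" for a b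
    using assms by (simp add: ucp_on_def completely_positive_on_def linear_map_on_def)
  show scale: "\<phi> (c *\<^sub>C a) = c *\<^sub>C \<phi> a"
    using assms by (simp add: ucp_on_def completely_positive_on_def linear_map_on_def)
  show "\<phi> 0 = 0" using add[of 0 0] by simp
  show "\<phi> (a - b) = \<phi> a - \<phi> b" using add[of "a - b" b] by simp
qed

lemma ucp_pos_matrix:
  "ucp_on UNIV \<phi> \<Longrightarrow> pos_matrix n a \<Longrightarrow> pos_matrix n (\<lambda>i j. \<phi> (a i j))"
  by (simp add: ucp_on_def completely_positive_on_def)

lemma S_map_ident: "S_map S (\<lambda>a. a)"
  by (simp add: S_map_def ucp_on_ident)

lemma S_map_comp: "S_map S \<phi> \<Longrightarrow> S_map S \<psi> \<Longrightarrow> S_map S (\<phi> \<circ> \<psi>)"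
  by (simp add: S_map_def ucp_on_def completely_positive_on_def linear_map_on_def)

lemma S_map_funpow: "S_map S \<phi> \<Longrightarrow> S_map S (\<phi> ^^ n)"
  by (induction n) (simp_all add: S_map_comp S_map_ident id_def)

lemma sum_nonneg_Reals: "(\<And>i. i \<in> I \<Longrightarrow> f i \<in> \<real>\<^sub>\<ge>\<^sub>0) \<Longrightarrow> (\<Sum>i\<in>I. f i) \<in> \<real>\<^sub>\<ge>\<^sub>0"
  by (induction I rule: infinite_finite_induct) simp_all

lemma S_map_average:
  assumes f: "\<And>i. S_map S (f i)"
  shows "S_map S (\<lambda>a. inverse (of_nat (Suc n)) *\<^sub>C (\<Sum>i\<le>n. f i a))"
proof -
  let ?c = "inverse (of_nat (Suc n)) :: complex"
  have ucp: "ucp_on UNIV (f i)" for i using f by (simp add: S_map_def)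
  have const: "?c *\<^sub>C (\<Sum>i\<le>n. a) = a" for a :: "'a bop"
  proof -
    have "(\<Sum>i\<le>m. a) = of_nat (Suc m) *\<^sub>C a" for m
    proof (induction m)
      case (Suc m)
      then show ?case by (simp only: sum.atMost_Suc of_nat_Suc scaleC_add_left scaleC_one add_ac)
    qed (simp add: scaleC_one)
    then show ?thesis by (simp add: scaleC_scaleC scaleC_one del: of_nat_Suc)
  qed
  have "pos_matrix m (\<lambda>i j. ?c *\<^sub>C (\<Sum>l\<le>n. f l (a i j)))" if a: "pos_matrix m a" for m a
    unfolding pos_matrix_iff
  proof
    fix \<xi>
    have "(\<Sum>i<m. \<Sum>j<m. cinner (op_apply (?c *\<^sub>C (\<Sum>l\<le>n. f l (a i j))) (\<xi> j)) (\<xi> i))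
        = ?c * (\<Sum>l\<le>n. \<Sum>i<m. \<Sum>j<m. cinner (op_apply (f l (a i j)) (\<xi> j)) (\<xi> i))"
      by (simp add: op_apply_scaleC_op op_apply_sum cinner_scaleC_left cinner_sum_left
          sum.swap[of _ "{..n}"] flip: sum_distrib_left)
    also have "\<dots> \<in> \<real>\<^sub>\<ge>\<^sub>0"
    proof (intro nonneg_Reals_mult_I sum_nonneg_Reals[of "{..n}"])
      show "(\<Sum>i<m. \<Sum>j<m. cinner (op_apply (f l (a i j)) (\<xi> j)) (\<xi> i)) \<in> \<real>\<^sub>\<ge>\<^sub>0" for l
        using ucp_pos_matrix[OF ucp a] by (simp add: pos_matrix_iff)
    qed (simp del: of_nat_Suc)
    finally show "(\<Sum>i<m. \<Sum>j<m. cinner (op_apply (?c *\<^sub>C (\<Sum>l\<le>n. f l (a i j))) (\<xi> j)) (\<xi> i)) \<in> \<real>\<^sub>\<ge>\<^sub>0" .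
  qed
  moreover have "(\<Sum>i\<le>n. f i (c *\<^sub>C a)) = c *\<^sub>C (\<Sum>i\<le>n. f i a)" for c a
    by (simp add: ucp_linear[OF ucp] complex_vector.scale_sum_right)
  moreover have "f i s = s" if "s \<in> S \<or> s = 1" for i s
    using f that by (auto simp: S_map_def ucp_on_def)
  ultimately show ?thesis
    unfolding S_map_def ucp_on_def completely_positive_on_def linear_map_on_def
    by (simp add: ucp_linear[OF ucp] sum.distrib scaleC_add_right scaleC_scaleC const mult.commute
        del: of_nat_Suc)
qed

text \<open>The topology is pointwise convergence of the forms, that is, the point-weak topology. By
  Tychonoff's theorem it makes the set of \<open>S\<close>-maps compact.\<close>

definition form_point :: "('h::complex_hilbert_space bop \<Rightarrow> 'h bop) \<Rightarrow> 'h bop \<times> 'h \<times> 'h \<Rightarrow> complex" where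
  "form_point \<phi> = (\<lambda>(a, x, y). form_of \<phi> a x y)"

lemma inj_form_point: "inj form_point"
proof (rule injI)
  fix \<phi> \<psi> :: "'a bop \<Rightarrow> 'a bop"
  assume "form_point \<phi> = form_point \<psi>"
  then have "form_of \<phi> a x y = form_of \<psi> a x y" for a x y
    by (metis form_point_def case_prod_conv)
  then show "\<phi> = \<psi>" by (intro ext bop_eqI_form) (simp add: form_of_def)
qed

lemma compact_S_maps:
  fixes S :: "'h::complex_hilbert_space bop set"
  shows "compact (form_point ` {\<phi>. S_map S \<phi>})"
proof -
  define K :: "('h bop \<times> 'h \<times> 'h \<Rightarrow> complex) set"
    where "K = PiE UNIV (\<lambda>(a, x, y). cball 0 (norm a * norm x * norm y))"
  define C :: "('h bop \<times> 'h \<times> 'h \<Rightarrow> complex) set"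
    where "C = {F. ucp_form UNIV (\<lambda>a x y. F (a, x, y)) \<and>
      (\<forall>s x y. s \<in> S \<longrightarrow> F (s, x, y) = cinner (op_apply s x) y)}"
  have "compact K"
  proof -
    have "compactin (product_topology (\<lambda>i. euclidean) UNIV) K"
      unfolding K_def compactin_PiE by auto
    then show ?thesis by (simp add: euclidean_product_topology)
  qed
  moreover have "closed C"
  proof -
    have nonneg: "closed {F :: 'h bop \<times> 'h \<times> 'h \<Rightarrow> complex.
        (\<Sum>i<n. \<Sum>j<n. F (a i j, \<xi> j, \<xi> i)) \<in> \<real>\<^sub>\<ge>\<^sub>0}" for n :: nat and a \<xi>
      using closed_vimage[OF closed_nonneg_Reals_complex,
          of "\<lambda>F :: 'h bop \<times> 'h \<times> 'h \<Rightarrow> complex. \<Sum>i<n. \<Sum>j<n. F (a i j, \<xi> j, \<xi> i)"]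
      by (simp add: vimage_def continuous_on_sum)
    have imp: "closed {F :: 'h bop \<times> 'h \<times> 'h \<Rightarrow> complex. P \<longrightarrow> Q F}" if "closed {F. Q F}" for P Q
      using that by (cases P) simp_all
    show ?thesis
      unfolding C_def ucp_form_def Ball_def
      by (intro closed_Collect_conj closed_Collect_all imp nonneg closed_Collect_eq
          continuous_intros continuous_on_product_coordinates)
  qed
  moreover have "form_point ` {\<phi>. S_map S \<phi>} = K \<inter> C"
  proof (intro equalityI subsetI)
    fix F assume "F \<in> form_point ` {\<phi>. S_map S \<phi>}"
    then obtain \<phi> where \<phi>: "S_map S \<phi>" "F = form_point \<phi>" by blast
    then have form: "ucp_form UNIV (form_of \<phi>)" by (simp add: S_map_def ucp_form_form_of)
    have "F \<in> K"
      using ucp_form_bound[OF operator_system_UNIV form] by (auto simp: K_def \<phi> form_point_def)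
    moreover have "(\<lambda>a x y. F (a, x, y)) = form_of \<phi>"
      by (simp add: fun_eq_iff \<phi> form_point_def)
    then have "ucp_form UNIV (\<lambda>a x y. F (a, x, y))" using form by simp
    then have "F \<in> C"
      using \<phi> by (simp add: C_def S_map_def form_point_def form_of_def)
    ultimately show "F \<in> K \<inter> C" by blast
  next
    fix F assume "F \<in> K \<inter> C"
    then have "ucp_form UNIV (\<lambda>a x y. F (a, x, y))"
      and fix_S: "\<And>s x y. s \<in> S \<Longrightarrow> F (s, x, y) = cinner (op_apply s x) y"
      by (auto simp: C_def)
    then obtain \<phi> where \<phi>: "ucp_on UNIV \<phi>" "(\<lambda>a x y. F (a, x, y)) = form_of \<phi>"
      using ucp_form_imp_ucp by blast
    have F: "F (a, x, y) = form_of \<phi> a x y" for a x y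
      using \<phi>(2) by (simp add: fun_eq_iff)
    then have "F = form_point \<phi>" by (auto simp: form_point_def)
    moreover have "\<phi> s = s" if "s \<in> S" for s
      using fix_S[OF that] by (intro bop_eqI_form) (simp add: F form_of_def)
    ultimately show "F \<in> form_point ` {\<phi>. S_map S \<phi>}" using \<phi> by (auto simp: S_map_def)
  qed
  ultimately show ?thesis by (simp add: compact_Int_closed)
qed

definition left_ideal ::
    "'h::complex_hilbert_space bop set \<Rightarrow> ('h bop \<Rightarrow> 'h bop) \<Rightarrow> ('h bop \<Rightarrow> 'h bop) set" where
  "left_ideal S g = {\<phi> \<circ> g |\<phi>. S_map S \<phi>}"

lemma self_in_left_ideal: "g \<in> left_ideal S g"
  unfolding left_ideal_def using S_map_ident by (force simp: comp_def)

lemma left_ideal_mono: "h \<in> left_ideal S g \<Longrightarrow> left_ideal S h \<subseteq> left_ideal S g"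
  by (auto simp: left_ideal_def comp_assoc[symmetric] intro: S_map_comp)

lemma compact_left_ideal: "compact (form_point ` left_ideal S g)"
proof -
  let ?T = "\<lambda>F :: _ \<Rightarrow> complex. \<lambda>p. F (g (fst p), snd p)"
  have "?T (form_point \<phi>) = form_point (\<phi> \<circ> g)" for \<phi>
    by (auto simp: form_point_def form_of_def)
  then have "form_point ` left_ideal S g = ?T ` form_point ` {\<phi>. S_map S \<phi>}"
    by (auto simp: left_ideal_def image_iff)
  moreover have "continuous_on X ?T" for X
    by (rule continuous_on_subset[OF _ subset_UNIV])
      (intro continuous_on_coordinatewise_then_product continuous_on_product_coordinates)
  then have "compact (?T ` form_point ` {\<phi>. S_map S \<phi>})"
    by (rule compact_continuous_image[OF _ compact_S_maps])
  ultimately show ?thesis by simp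
qed

lemma compact_imp_closed_fun:
  fixes K :: "('a \<Rightarrow> 'b::metric_space) set"
  assumes "compact K"
  shows "closed K"
proof -
  have "Hausdorff_space (product_topology (\<lambda>i :: 'a. euclidean :: 'b topology) UNIV)"
    using Hausdorff_space_product_topology Hausdorff_space_euclidean by blast
  then show ?thesis
    using compactin_imp_closedin[of euclidean K] assms by (simp add: euclidean_product_topology)
qed

lemma compact_chain_Inter_nonempty:
  assumes "C \<noteq> {}" and compact: "\<And>K. K \<in> C \<Longrightarrow> compact K" and closed: "\<And>K. K \<in> C \<Longrightarrow> closed K"
    and ne: "{} \<notin> C" and chain: "\<And>K L. K \<in> C \<Longrightarrow> L \<in> C \<Longrightarrow> K \<subseteq> L \<or> L \<subseteq> K"
  shows "\<Inter>C \<noteq> {}"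
proof -
  obtain K0 where K0: "K0 \<in> C" using assms(1) by blast
  have "K0 \<inter> \<Inter>C \<noteq> {}"
  proof (rule compact_imp_fip[OF compact[OF K0] closed])
    fix F assume F: "finite F" "F \<subseteq> C"
    have "finite (insert K0 F)" "insert K0 F \<noteq> {}" using F by simp_all
    then obtain m where m: "m \<in> insert K0 F" "\<And>K. K \<in> insert K0 F \<Longrightarrow> K \<subseteq> m \<Longrightarrow> m = K"
      using finite_has_minimal by metis
    then have "m \<subseteq> K" if "K \<in> insert K0 F" for K
      using chain[of m K] that F K0 by blast
    moreover have "m \<noteq> {}" using m(1) F K0 ne by auto
    ultimately show "K0 \<inter> \<Inter>F \<noteq> {}" by blast
  qed
  then show ?thesis by blast
qed

text \<open>Principal left ideals are compact, so the members of a chain of them have a common element, and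
  the left ideal that it generates is a lower bound of the chain.\<close>

lemma minimal_left_ideal_exists:
  "\<exists>g\<in>left_ideal S \<theta>. \<forall>h\<in>left_ideal S g. left_ideal S h = left_ideal S g"
proof -
  define \<L> where "\<L> = left_ideal S ` left_ideal S \<theta>"
  have "\<exists>M\<in>\<L>. \<forall>N\<in>\<L>. N \<subseteq> M \<longrightarrow> N = M"
  proof (rule predicate_Zorn)
    show "partial_order_on \<L> (relation_of (\<lambda>M N. N \<subseteq> M) \<L>)"
      by (rule partial_order_on_relation_ofI) auto
    fix C assume "C \<in> Chains (relation_of (\<lambda>M N. N \<subseteq> M) \<L>)"
    then have C: "C \<subseteq> \<L>" and chain: "\<And>M N. M \<in> C \<Longrightarrow> N \<in> C \<Longrightarrow> M \<subseteq> N \<or> N \<subseteq> M"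
      by (auto simp: Chains_def relation_of_def)
    show "\<exists>U\<in>\<L>. \<forall>M\<in>C. U \<subseteq> M"
    proof (cases "C = {}")
      case True
      then show ?thesis using self_in_left_ideal by (auto simp: \<L>_def)
    next
      case False
      have "\<Inter>((`) form_point ` C) \<noteq> {}"
      proof (rule compact_chain_Inter_nonempty)
        show compact: "compact K" if "K \<in> (`) form_point ` C" for K
          using that C compact_left_ideal by (auto simp: \<L>_def)
        show "closed K" if "K \<in> (`) form_point ` C" for K
          by (rule compact_imp_closed_fun[OF compact[OF that]])
        show "{} \<notin> (`) form_point ` C"
          using C self_in_left_ideal by (fastforce simp: \<L>_def)
        show "K \<subseteq> L \<or> L \<subseteq> K" if KL: "K \<in> (`) form_point ` C" "L \<in> (`) form_point ` C" for K L
        proof -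
          obtain M N where "M \<in> C" "N \<in> C" "K = form_point ` M" "L = form_point ` N"
            using KL by auto
          then show ?thesis using chain[of M N] by auto
        qed
      qed (use False in simp)
      then obtain F where F: "\<And>M. M \<in> C \<Longrightarrow> F \<in> form_point ` M" by auto
      obtain M0 where M0: "M0 \<in> C" using False by blast
      with F obtain h where "F = form_point h" by blast
      then have h: "h \<in> M" if "M \<in> C" for M
        using F[OF that] by (simp add: inj_image_mem_iff[OF inj_form_point])
      have "left_ideal S h \<subseteq> M" if M: "M \<in> C" for M
      proof -
        obtain g where g: "M = left_ideal S g" using M C by (auto simp: \<L>_def)
        then have "h \<in> left_ideal S g" using h[OF M] by simp
        then show ?thesis unfolding g by (rule left_ideal_mono)
      qed
      moreover have "h \<in> left_ideal S \<theta>"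
      proof -
        obtain g where "g \<in> left_ideal S \<theta>" "M0 = left_ideal S g"
          using M0 C by (auto simp: \<L>_def)
        then show ?thesis using h[OF M0] left_ideal_mono[of g S \<theta>] by auto
      qed
      ultimately show ?thesis by (auto simp: \<L>_def)
    qed
  qed
  then obtain g where g: "g \<in> left_ideal S \<theta>"
    and min: "\<And>h. h \<in> left_ideal S \<theta> \<Longrightarrow> left_ideal S h \<subseteq> left_ideal S g \<Longrightarrow> left_ideal S h = left_ideal S g"
    by (auto simp: \<L>_def)
  have "left_ideal S h = left_ideal S g" if "h \<in> left_ideal S g" for h
    using that left_ideal_mono[OF g] left_ideal_mono[OF that] by (intro min) auto
  then show ?thesis using g by blast
qed

text \<open>Let \<open>A = B \<circ> k\<close> be the average
  of \<open>k, k\<^sup>2, \<dots>, k ^^ (n + 1)\<close>, which belongs to the ideal because \<open>B\<close> is an \<open>S\<close>-map. By minimality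
  \<open>h = \<psi> \<circ> A\<close> for a contraction \<open>\<psi>\<close>, while \<open>A (x - k x)\<close> telescopes to a term of norm at most
  \<open>2 \<parallel>x\<parallel> / (n + 1)\<close>. Hence \<open>h (x - k x) = 0\<close>.\<close>

lemma minimal_left_ideal_left_zero:
  assumes g: "S_map S g" and min: "\<And>h. h \<in> left_ideal S g \<Longrightarrow> left_ideal S h = left_ideal S g"
    and h: "h \<in> left_ideal S g" and k: "k \<in> left_ideal S g"
  shows "h \<circ> k = h"
proof
  fix x
  have S_map: "S_map S k" using g k by (auto simp: left_ideal_def intro: S_map_comp)
  have contractive: "norm (\<phi> a) \<le> norm a" if "S_map S \<phi>" for \<phi> a
    using that by (intro ucp_norm_le[OF operator_system_UNIV]) (simp_all add: S_map_def)
  have bound: "norm (h (x - k x)) \<le> inverse (real (Suc n)) * (2 * norm x)" for n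
  proof -
    let ?c = "inverse (of_nat (Suc n)) :: complex"
    define B where "B = (\<lambda>a. ?c *\<^sub>C (\<Sum>i\<le>n. (k ^^ i) a))"
    have "S_map S B" unfolding B_def by (intro S_map_average S_map_funpow S_map)
    then have "B \<circ> k \<in> left_ideal S k" by (auto simp: left_ideal_def)
    then have "left_ideal S (B \<circ> k) = left_ideal S g"
      using k left_ideal_mono by (intro min) blast
    then obtain \<psi> where \<psi>: "S_map S \<psi>" "h = \<psi> \<circ> (B \<circ> k)"
      using h by (auto simp: left_ideal_def)
    have lin: "ucp_on UNIV k" "ucp_on UNIV B"
      using S_map \<open>S_map S B\<close> by (simp_all add: S_map_def)
    have "(\<Sum>i\<le>n. (k ^^ i) (k x)) - (\<Sum>i\<le>n. (k ^^ i) (k (k x))) = k x - (k ^^ Suc n) (k x)"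
      by (induction n) (simp_all add: funpow_swap1 algebra_simps)
    then have "B (k (x - k x)) = ?c *\<^sub>C (k x - (k ^^ Suc n) (k x))"
      unfolding ucp_linear[OF lin(1)] ucp_linear[OF lin(2)]
      unfolding B_def complex_vector.scale_right_diff_distrib[symmetric] by simp
    also have "\<dots> = inverse (real (Suc n)) *\<^sub>R (k x - (k ^^ Suc n) (k x))"
      by (simp add: scaleR_scaleC)
    finally have "norm (B (k (x - k x))) = inverse (real (Suc n)) * norm (k x - (k ^^ Suc n) (k x))"
      by simp
    also have "norm (k x - (k ^^ Suc n) (k x)) \<le> norm (k x) + norm ((k ^^ Suc n) (k x))"
      by (rule norm_triangle_ineq4)
    also have "\<dots> \<le> 2 * norm (k x)"
      using contractive[OF S_map_funpow[OF S_map], of "Suc n" "k x"] by simp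
    also have "\<dots> \<le> 2 * norm x" using contractive[OF S_map, of x] by simp
    finally have "norm (B (k (x - k x))) \<le> inverse (real (Suc n)) * (2 * norm x)"
      by (simp add: mult_left_mono)
    then show ?thesis
      using contractive[OF \<psi>(1), of "B (k (x - k x))"] by (simp add: \<psi>(2))
  qed
  have "(\<lambda>n. inverse (real (Suc n)) * (2 * norm x)) \<longlonglongrightarrow> 0"
    by (rule tendsto_mult_left_zero[OF LIMSEQ_inverse_real_of_nat])
  then have "norm (h (x - k x)) \<le> 0"
    by (rule LIMSEQ_le_const) (use bound in blast)
  moreover have "S_map S h" using g h by (auto simp: left_ideal_def intro: S_map_comp)
  then have "ucp_on UNIV h" by (simp add: S_map_def)
  ultimately show "(h \<circ> k) x = h x" by (simp add: ucp_linear)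
qed

text \<open>Rigidity. Let \<open>g\<close> generate a minimal left ideal inside that of \<open>\<theta>\<close>. The element \<open>\<theta> \<circ> g\<close> of this
  ideal is idempotent by the multiplication rule above and lies below \<open>\<theta>\<close>, so it is equal to \<open>\<theta>\<close>.
  Thus \<open>\<theta>\<close> and \<open>\<phi> \<circ> \<theta>\<close> belong to the ideal, and the rule applies to them.\<close>

lemma minimal_S_projection_rigid:
  assumes \<theta>: "minimal_S_projection S \<theta>" and \<phi>: "S_map S \<phi>"
  shows "\<theta> \<circ> \<phi> \<circ> \<theta> = \<theta>"
proof -
  have S_map: "S_map S \<theta>" and idem: "\<theta> \<circ> \<theta> = \<theta>"
    using \<theta> by (auto simp: minimal_S_projection_def S_projection_def)
  obtain g where g: "g \<in> left_ideal S \<theta>"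
    and min: "\<And>h. h \<in> left_ideal S g \<Longrightarrow> left_ideal S h = left_ideal S g"
    using minimal_left_ideal_exists by metis
  have "S_map S g" using g S_map by (auto simp: left_ideal_def intro: S_map_comp)
  then have left_zero: "h \<circ> k = h" if "h \<in> left_ideal S g" "k \<in> left_ideal S g" for h k
    using that by (intro minimal_left_ideal_left_zero[OF _ min])
  define \<psi> where "\<psi> = \<theta> \<circ> g"
  have mem: "\<psi> \<in> left_ideal S g" using S_map by (auto simp: \<psi>_def left_ideal_def)
  have "S_map S \<psi>" unfolding \<psi>_def by (intro S_map_comp S_map \<open>S_map S g\<close>)
  moreover have "\<psi> \<circ> \<psi> = \<psi>" by (rule left_zero[OF mem mem])
  moreover have "\<theta> \<circ> \<psi> = \<psi>" by (simp add: \<psi>_def idem flip: comp_assoc)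
  moreover have "g \<circ> \<theta> = g" using g idem by (auto simp: left_ideal_def comp_assoc)
  then have "\<psi> \<circ> \<theta> = \<psi>" by (simp add: \<psi>_def comp_assoc)
  ultimately have "\<psi> = \<theta>"
    using \<theta> by (auto simp: minimal_S_projection_def S_projection_def proj_le_def)
  with mem have \<theta>_mem: "\<theta> \<in> left_ideal S g" by simp
  moreover have "\<phi> \<circ> \<theta> \<in> left_ideal S \<theta>" using \<phi> by (auto simp: left_ideal_def)
  then have "\<phi> \<circ> \<theta> \<in> left_ideal S g" using left_ideal_mono[OF \<theta>_mem] by blast
  ultimately show ?thesis using left_zero by (simp add: comp_assoc)
qed


section \<open>Projections with the same range\<close>

definition pos_op :: "'h::complex_hilbert_space bop \<Rightarrow> bool" where
  "pos_op a \<longleftrightarrow> (\<forall>\<xi>. cinner (op_apply a \<xi>) \<xi> \<in> \<real>\<^sub>\<ge>\<^sub>0)"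

lemma pos_op_iff_pos_matrix: "pos_op a \<longleftrightarrow> pos_matrix 1 (\<lambda>_ _. a)"
  unfolding pos_op_def pos_matrix_iff
proof (intro iffI allI)
  fix x
  assume "\<forall>\<xi> :: nat \<Rightarrow> 'a. (\<Sum>i<1. \<Sum>j<1. cinner (op_apply a (\<xi> j)) (\<xi> i)) \<in> \<real>\<^sub>\<ge>\<^sub>0"
  from spec[OF this, of "\<lambda>_. x"] show "cinner (op_apply a x) x \<in> \<real>\<^sub>\<ge>\<^sub>0" by simp
qed simp

lemma ucp_pos_op: "ucp_on UNIV \<phi> \<Longrightarrow> pos_op a \<Longrightarrow> pos_op (\<phi> a)"
  unfolding pos_op_iff_pos_matrix by (rule ucp_pos_matrix)

lemma pos_op_antisym:
  assumes "pos_op (a - b)" "pos_op (b - a)"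
  shows "a = b"
proof -
  define d where "d = a - b"
  have zero: "cinner (op_apply d \<xi>) \<xi> = 0" for \<xi>
  proof -
    have "cinner (op_apply (a - b) \<xi>) \<xi> \<in> \<real>\<^sub>\<ge>\<^sub>0" "cinner (op_apply (b - a) \<xi>) \<xi> \<in> \<real>\<^sub>\<ge>\<^sub>0"
      using assms by (simp_all add: pos_op_def)
    then show ?thesis
      by (simp add: d_def complex_nonneg_Reals_iff op_apply_diff cinner_diff_left complex_eq_iff)
  qed
  have "cinner (op_apply d x) y = 0" for x y
  proof -
    have "cinner (op_apply d x) y + cinner (op_apply d y) x = 0"
      using zero[of "x + y"]
      by (simp add: op_apply_add_arg cinner_add_left cinner_add_right zero add.commute)
    moreover have "\<i> * (cinner (op_apply d y) x - cinner (op_apply d x) y) = 0"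
      using zero[of "x + \<i> *\<^sub>C y"]
      by (simp add: op_apply_add_arg cinner_add_left cinner_add_right zero op_apply_scaleC
          cinner_scaleC_left cinner_scaleC_right algebra_simps)
    ultimately show ?thesis by (simp add: complex_eq_iff)
  qed
  then have "d = 0" by (intro bop_eqI_form) simp
  then show ?thesis by (simp add: d_def)
qed

lemma pos_matrix_gram: "pos_matrix n (\<lambda>i j. adj (x i) * x j)"
  unfolding pos_matrix_iff
proof
  fix \<xi> :: "nat \<Rightarrow> 'a"
  let ?z = "\<Sum>i<n. op_apply (x i) (\<xi> i)"
  have "(\<Sum>i<n. \<Sum>j<n. cinner (op_apply (adj (x i) * x j) (\<xi> j)) (\<xi> i)) = cinner ?z ?z"
    by (simp add: op_apply_mult cinner_adj_left cinner_sum_left cinner_sum_right)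
  then show "(\<Sum>i<n. \<Sum>j<n. cinner (op_apply (adj (x i) * x j) (\<xi> j)) (\<xi> i)) \<in> \<real>\<^sub>\<ge>\<^sub>0"
    by (simp add: cinner_self)
qed

lemma ucp_adj_UNIV: "ucp_on UNIV \<phi> \<Longrightarrow> \<phi> (adj a) = adj (\<phi> a)"
  by (simp add: ucp_adj[OF operator_system_UNIV])

lemma ucp_one: "ucp_on UNIV \<phi> \<Longrightarrow> \<phi> 1 = 1"
  by (simp add: ucp_on_def)

text \<open>The Schwarz inequality is the Schur complement of the image of the Gram matrix of \<open>1, x\<close>.\<close>

lemma ucp_schwarz:
  assumes \<phi>: "ucp_on UNIV \<phi>"
  shows "pos_op (\<phi> (adj x * x) - adj (\<phi> x) * \<phi> x)"
  unfolding pos_op_def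
proof
  fix \<xi>
  let ?x = "\<lambda>i::nat. if i = 0 then 1 else x" and ?\<xi> = "\<lambda>i::nat. if i = 0 then - op_apply (\<phi> x) \<xi> else \<xi>"
  have "(\<Sum>i<2. \<Sum>j<2. cinner (op_apply (\<phi> (adj (?x i) * ?x j)) (?\<xi> j)) (?\<xi> i)) \<in> \<real>\<^sub>\<ge>\<^sub>0"
    using ucp_pos_matrix[OF \<phi> pos_matrix_gram[of 2 ?x]] unfolding pos_matrix_iff by (rule spec)
  then show "cinner (op_apply (\<phi> (adj x * x) - adj (\<phi> x) * \<phi> x) \<xi>) \<xi> \<in> \<real>\<^sub>\<ge>\<^sub>0"
    by (simp add: numeral_2_eq_2 ucp_one[OF \<phi>] ucp_adj_UNIV[OF \<phi>] cinner_adj_left op_apply_diff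
        op_apply_mult cinner_diff_left op_apply_minus_arg cinner_minus_left cinner_minus_right)
qed

text \<open>If \<open>\<theta>\<close> and \<open>\<psi>\<close> are the identity on each other's range, then the Schwarz inequality for \<open>\<psi>\<close>
  followed by \<open>\<theta>\<close> gives \<open>\<psi> (x\<^sup>* x) \<ge> \<theta> (x\<^sup>* x)\<close> on this range, and symmetrically. The general
  products follow by polarization: the Choi-Effros product on the range does not depend on the
  projection.\<close>

lemma same_range_product:
  assumes \<theta>: "ucp_on UNIV \<theta>" and \<psi>: "ucp_on UNIV \<psi>"
    and \<theta>\<psi>: "\<And>a. \<theta> (\<psi> a) = \<psi> a" and \<psi>\<theta>: "\<And>a. \<psi> (\<theta> a) = \<theta> a"
    and x: "\<theta> x = x" and y: "\<theta> y = y"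
  shows "\<theta> (adj x * y) = \<psi> (adj x * y)"
proof -
  have square: "\<theta> (adj z * z) = \<psi> (adj z * z)" if z: "\<theta> z = z" for z
  proof (rule pos_op_antisym)
    have "\<psi> z = z" using \<psi>\<theta>[of z] z by simp
    show "pos_op (\<psi> (adj z * z) - \<theta> (adj z * z))"
      using ucp_pos_op[OF \<theta> ucp_schwarz[OF \<psi>, of z]] \<open>\<psi> z = z\<close>
      by (simp add: ucp_linear[OF \<theta>] \<theta>\<psi>)
    show "pos_op (\<theta> (adj z * z) - \<psi> (adj z * z))"
      using ucp_pos_op[OF \<psi> ucp_schwarz[OF \<theta>, of z]] z
      by (simp add: ucp_linear[OF \<psi>] \<psi>\<theta>)
  qed
  define D where "D a = \<theta> a - \<psi> a" for a
  have D: "D (a + b) = D a + D b" "D (a - b) = D a - D b" "D (c *\<^sub>C a) = c *\<^sub>C D a" for a b c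
    by (simp_all add: D_def ucp_linear[OF \<theta>] ucp_linear[OF \<psi>] complex_vector.scale_right_diff_distrib)
  have zero: "D (adj z * z) = 0" if "\<theta> z = z" for z using square[OF that] by (simp add: D_def)
  have "D (adj x * y) + D (adj y * x) = 0"
    using zero[of "x + y"] zero[OF x] zero[OF y]
    by (simp add: ucp_linear[OF \<theta>] x y adj_add algebra_simps D)
  moreover have "\<i> *\<^sub>C D (adj x * y) = \<i> *\<^sub>C D (adj y * x)"
    using zero[of "x + \<i> *\<^sub>C y"] zero[OF x] zero[OF y]
    by (simp add: ucp_linear[OF \<theta>] x y adj_add adj_scaleC algebra_simps D scaleC_mult_left
        scaleC_mult_right scaleC_scaleC)
  then have "D (adj x * y) = D (adj y * x)"
    by simp
  ultimately have "2 *\<^sub>C D (adj x * y) = 0"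
    using scaleC_add_left[of 1 1 "D (adj x * y)"] by (simp add: scaleC_one)
  then show ?thesis by (simp add: D_def)
qed

text \<open>The Choi-Effros identity. With \<open>d = b - \<theta> b\<close>, the Schur complement of the image under \<open>\<theta>\<close>
  of the Gram matrix of \<open>1, s\<^sup>*, d\<close> is a positive matrix whose upper left entry
  \<open>\<theta> (s s\<^sup>*) - s s\<^sup>*\<close> is annihilated by \<open>\<theta>\<close>. A second application of \<open>\<theta>\<close> thus yields a positive
  matrix with a zero on the diagonal, whose off-diagonal entry \<open>\<theta> (s d)\<close> must vanish.\<close>

lemma choi_effros_identity:
  assumes \<theta>: "ucp_on UNIV \<theta>" and idem: "\<And>a. \<theta> (\<theta> a) = \<theta> a" and s: "\<theta> s = s"
  shows "\<theta> (s * b) = \<theta> (s * \<theta> b)"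
proof -
  define d where "d = b - \<theta> b"
  define T where "T = \<theta> (s * d)"
  note lin = ucp_linear[OF \<theta>]
  have d: "\<theta> d = 0" by (simp add: d_def lin idem)
  have adj_s: "\<theta> (adj s) = adj s" and adj_d: "\<theta> (adj d) = 0"
    by (simp_all add: ucp_adj_UNIV[OF \<theta>] s d)
  have T': "\<theta> (adj d * adj s) = adj T"
    by (simp add: T_def flip: adj_mult ucp_adj_UNIV[OF \<theta>])
  let ?x = "\<lambda>i::nat. if i = 0 then 1 else if i = 1 then adj s else d"
  let ?M = "\<lambda>i j::nat. if i = 0 then (if j = 0 then \<theta> (s * adj s) - s * adj s else T)
    else (if j = 0 then adj T else \<theta> (adj d * d))"
  have "pos_matrix 2 ?M"
    unfolding pos_matrix_iff
  proof
    fix \<xi> :: "nat \<Rightarrow> 'a"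
    let ?\<xi> = "\<lambda>i::nat. if i = 0 then - op_apply (adj s) (\<xi> 0) else \<xi> (i - 1)"
    have "(\<Sum>i<3. \<Sum>j<3. cinner (op_apply (\<theta> (adj (?x i) * ?x j)) (?\<xi> j)) (?\<xi> i)) \<in> \<real>\<^sub>\<ge>\<^sub>0"
      using ucp_pos_matrix[OF \<theta> pos_matrix_gram[of 3 ?x]] unfolding pos_matrix_iff by (rule spec)
    also have "(\<Sum>i<3. \<Sum>j<3. cinner (op_apply (\<theta> (adj (?x i) * ?x j)) (?\<xi> j)) (?\<xi> i))
        = (\<Sum>i<2. \<Sum>j<2. cinner (op_apply (?M i j) (\<xi> j)) (\<xi> i))"
      by (simp add: numeral_2_eq_2 numeral_3_eq_3 ucp_one[OF \<theta>] s d adj_s adj_d T' op_apply_diff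
          op_apply_mult cinner_diff_left op_apply_minus_arg cinner_minus_left cinner_minus_right
          cinner_adj_left flip: T_def)
    finally show "(\<Sum>i<2. \<Sum>j<2. cinner (op_apply (?M i j) (\<xi> j)) (\<xi> i)) \<in> \<real>\<^sub>\<ge>\<^sub>0" .
  qed
  then have pos: "pos_matrix 2 (\<lambda>i j. \<theta> (?M i j))" by (rule ucp_pos_matrix[OF \<theta>])
  have "op_apply T \<xi> = 0" for \<xi>
  proof (rule ccontr)
    assume "op_apply T \<xi> \<noteq> 0"
    define N where "N = (norm (op_apply T \<xi>))\<^sup>2"
    have N: "0 < N" using \<open>op_apply T \<xi> \<noteq> 0\<close> by (simp add: N_def)
    define K where "K = Re (cinner (op_apply (\<theta> (adj d * d)) \<xi>) \<xi>)"
    have "0 \<le> K - 2 * t * N" for t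
    proof -
      let ?\<xi> = "\<lambda>i::nat. if i = 0 then complex_of_real (- t) *\<^sub>C op_apply T \<xi> else \<xi>"
      have "(\<Sum>i<2. \<Sum>j<2. cinner (op_apply (\<theta> (?M i j)) (?\<xi> j)) (?\<xi> i)) \<in> \<real>\<^sub>\<ge>\<^sub>0"
        using pos unfolding pos_matrix_iff by (rule spec)
      moreover have "\<theta> T = T" "\<theta> (adj T) = adj T"
        by (simp_all add: T_def idem ucp_adj_UNIV[OF \<theta>])
      ultimately show ?thesis
        by (simp add: numeral_2_eq_2 lin idem s K_def N_def cinner_scaleC_left
            cinner_scaleC_right cinner_adj_left op_apply_scaleC cinner_self complex_nonneg_Reals_iff
            cinner_minus_left cinner_minus_right algebra_simps
            flip: of_real_power)
    qed
    from this[of "(K + 1) / (2 * N)"] N show False by simp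
  qed
  then have "T = 0" by (intro bop_eqI) simp
  then show ?thesis by (simp add: T_def d_def right_diff_distrib lin)
qed


section \<open>The generated algebra\<close>

lemma cstar_subalgebra_generated: "cstar_subalgebra (cstar_generated S)"
  unfolding cstar_generated_def
  by (rule hull_in) (auto simp: cstar_subalgebra_def intro!: complex_vector.subspace_Inter closed_Inter)

lemma subset_cstar_generated: "S \<subseteq> cstar_generated S"
  unfolding cstar_generated_def by (rule hull_subset)

lemma operator_system_cstar_generated:
  "operator_system S \<Longrightarrow> operator_system (cstar_generated S)"
  using cstar_subalgebra_generated[of S] subset_cstar_generated[of S]
  by (auto simp: operator_system_def cstar_subalgebra_def)

lemma bounded_linear_mult_right_bop: "bounded_linear (\<lambda>a :: 'h::complex_hilbert_space bop. a * b)"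
  by (rule bounded_linear_intro[where K = "norm b"])
    (simp_all add: distrib_right scaleR_scaleC scaleC_mult_left norm_bop_mult_le)

lemma bounded_linear_adj: "bounded_linear (adj :: 'h::complex_hilbert_space bop \<Rightarrow> _)"
  by (rule bounded_linear_intro[where K = 1])
    (simp_all add: adj_add scaleR_scaleC adj_scaleC norm_adj_le)

lemma bounded_linear_ucp:
  assumes "ucp_on UNIV \<phi>"
  shows "bounded_linear \<phi>"
  using ucp_norm_le[OF operator_system_UNIV assms]
  by (intro bounded_linear_intro[where K = 1]) (simp_all add: ucp_linear[OF assms] scaleR_scaleC)

text \<open>The elements \<open>a\<close> for which left multiplication by \<open>a\<close> and by \<open>a\<^sup>*\<close> maps \<open>Z\<close> into itself form a
  C*-algebra that contains \<open>S\<close>. Applied to \<open>1 \<in> Z\<close>, such an \<open>a\<close> gives \<open>a \<in> Z\<close>.\<close>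

lemma cstar_generated_subset_left_stable:
  fixes S :: "'h::complex_hilbert_space bop set"
  assumes S: "operator_system S" and Z: "csubspace Z" "closed Z" "1 \<in> Z"
    and left: "\<And>s z. s \<in> S \<Longrightarrow> z \<in> Z \<Longrightarrow> s * z \<in> Z"
  shows "cstar_generated S \<subseteq> Z"
proof -
  define L where "L = {a. \<forall>z\<in>Z. a * z \<in> Z \<and> adj a * z \<in> Z}"
  have "cstar_subalgebra L"
    unfolding cstar_subalgebra_def
  proof (intro conjI ballI)
    show "csubspace L"
      using Z(1) by (simp add: L_def complex_vector.subspace_def distrib_right scaleC_mult_left
          adj_add adj_scaleC)
    show "a * b \<in> L" if "a \<in> L" "b \<in> L" for a b
      using that by (simp add: L_def adj_mult mult.assoc)
    show "adj a \<in> L" if "a \<in> L" for a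
      using that by (simp add: L_def)
    have "closed ((\<lambda>a. a * z) -` Z)" "closed ((\<lambda>a. adj a * z) -` Z)" for z
      using bounded_linear_mult_right_bop bounded_linear_compose[OF bounded_linear_mult_right_bop bounded_linear_adj]
      by (auto intro!: closed_vimage[OF Z(2)] linear_continuous_on)
    then have "closed (\<Inter>z\<in>Z. (\<lambda>a. a * z) -` Z \<inter> (\<lambda>a. adj a * z) -` Z)"
      by (intro closed_INT ballI closed_Int)
    moreover have "L = (\<Inter>z\<in>Z. (\<lambda>a. a * z) -` Z \<inter> (\<lambda>a. adj a * z) -` Z)"
      by (auto simp: L_def)
    ultimately show "closed L" by simp
  qed
  moreover have "S \<subseteq> L"
    using S left by (auto simp: L_def operator_system_def)
  ultimately have "cstar_generated S \<subseteq> L"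
    unfolding cstar_generated_def by (intro hull_minimal)
  moreover have "L \<subseteq> Z"
  proof
    fix a assume "a \<in> L"
    then have "a * 1 \<in> Z" using Z(3) unfolding L_def by blast
    then show "a \<in> Z" by simp
  qed
  ultimately show ?thesis by blast
qed

text \<open>The set where \<open>\<theta>\<close> and \<open>\<psi>\<close> agree is stable under left multiplication by \<open>s \<in> S\<close>: the Choi-Effros
  identity replaces \<open>s z\<close> by \<open>s \<theta> z\<close>, a product of elements of the common range.\<close>

lemma same_range_eq_on_cstar_generated:
  assumes S: "operator_system S" and \<theta>: "S_map S \<theta>" and \<psi>: "S_map S \<psi>"
    and \<theta>\<psi>: "\<And>a. \<theta> (\<psi> a) = \<psi> a" and \<psi>\<theta>: "\<And>a. \<psi> (\<theta> a) = \<theta> a" and a: "a \<in> cstar_generated S"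
  shows "\<theta> a = \<psi> a"
proof -
  have ucp: "ucp_on UNIV \<theta>" "ucp_on UNIV \<psi>" and fixes_S: "\<And>s. s \<in> S \<Longrightarrow> \<theta> s = s" "\<And>s. s \<in> S \<Longrightarrow> \<psi> s = s"
    using \<theta> \<psi> by (auto simp: S_map_def)
  have idem: "\<theta> (\<theta> a) = \<theta> a" "\<psi> (\<psi> a) = \<psi> a" for a
    using \<theta>\<psi>[of "\<theta> a"] \<psi>\<theta>[of "\<psi> a"] by (simp_all add: \<theta>\<psi> \<psi>\<theta>)
  define Z where "Z = {z. \<theta> z = \<psi> z}"
  have "cstar_generated S \<subseteq> Z"
  proof (rule cstar_generated_subset_left_stable[OF S])
    show "csubspace Z"
      by (simp add: Z_def complex_vector.subspace_def ucp_linear[OF ucp(1)] ucp_linear[OF ucp(2)])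
    show "closed Z"
      unfolding Z_def
      by (intro closed_Collect_eq linear_continuous_on bounded_linear_ucp ucp)
    show "1 \<in> Z" by (simp add: Z_def ucp_one ucp)
    show "s * z \<in> Z" if "s \<in> S" "z \<in> Z" for s z
    proof -
      have "adj s \<in> S" using S that by (simp add: operator_system_def)
      then have "\<theta> (adj (adj s) * \<theta> z) = \<psi> (adj (adj s) * \<theta> z)"
        using fixes_S idem by (intro same_range_product[OF ucp \<theta>\<psi> \<psi>\<theta>]) simp_all
      then have "\<theta> (s * \<theta> z) = \<psi> (s * \<psi> z)" using that by (simp add: Z_def)
      then show ?thesis
        using choi_effros_identity[OF ucp(1) idem(1), of s z]
          choi_effros_identity[OF ucp(2) idem(2), of s z] fixes_S that
        by (simp add: Z_def)
    qed
  qed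
  then show ?thesis using a by (auto simp: Z_def)
qed

text \<open>By rigidity \<open>\<theta> \<circ> \<phi>\<close> is the identity on the range of \<open>\<theta>\<close>.\<close>

lemma minimal_S_projection_absorbs:
  assumes S: "operator_system S" and \<theta>: "minimal_S_projection S \<theta>" and \<phi>: "S_map S \<phi>"
    and a: "a \<in> cstar_generated S"
  shows "\<theta> (\<phi> a) = \<theta> a"
proof -
  have S_map: "S_map S \<theta>" and idem: "\<theta> (\<theta> b) = \<theta> b" for b
    using \<theta> by (auto simp: minimal_S_projection_def S_projection_def fun_eq_iff)
  have rigid: "\<theta> (\<phi> (\<theta> b)) = \<theta> b" for b
    using minimal_S_projection_rigid[OF \<theta> \<phi>] by (simp add: fun_eq_iff)
  have "\<theta> a = (\<theta> \<circ> \<phi>) a"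
    by (rule same_range_eq_on_cstar_generated[OF S S_map S_map_comp[OF S_map \<phi>] _ _ a])
      (simp_all add: idem rigid)
  then show ?thesis by simp
qed


section \<open>The span of the abnormalities\<close>

theorem theorem4p3:
  fixes S :: "'h::complex_hilbert_space bop set" and \<theta> :: "'h bop \<Rightarrow> 'h bop"
  assumes "operator_system S"
    and "minimal_S_projection S \<theta>"
  shows "cspan (abnormalities S) = expanse S \<inter> {T. \<theta> T = 0}"
proof (intro equalityI subsetI)
  have S_map: "S_map S \<theta>" and idem: "\<theta> (\<theta> b) = \<theta> b" for b
    using assms(2) by (auto simp: minimal_S_projection_def S_projection_def fun_eq_iff)
  have ucp: "ucp_on UNIV \<theta>" using S_map by (simp add: S_map_def)
  note lin = ucp_linear[OF ucp]
  have restrict: "ucp_on (cstar_generated S) \<phi>" if "S_map S \<phi>" for \<phi>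
    using that by (simp add: S_map_def ucp_on_def completely_positive_on_def linear_map_on_def)
  have mem_expanse: "\<phi> a \<in> expanse S" if "S_map S \<phi>" "a \<in> cstar_generated S" for \<phi> a
    unfolding expanse_def using that by (intro complex_vector.span_base) auto
  have expanse: "csubspace (expanse S)"
    unfolding expanse_def by (rule complex_vector.subspace_span)
  have "abnormalities S \<subseteq> expanse S \<inter> {T. \<theta> T = 0}"
  proof
    fix x assume "x \<in> abnormalities S"
    then obtain \<phi> a where x: "x = \<phi> a - a" and a: "a \<in> cstar_generated S"
      and \<phi>: "ucp_on (cstar_generated S) \<phi>" "\<And>s. s \<in> S \<Longrightarrow> \<phi> s = s"
      by (auto simp: abnormalities_def)
    obtain \<psi> where \<psi>: "ucp_on UNIV \<psi>" "\<And>b. b \<in> cstar_generated S \<Longrightarrow> \<psi> b = \<phi> b"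
      using arveson_extension[OF operator_system_cstar_generated[OF assms(1)] \<phi>(1)] by blast
    have "S_map S \<psi>"
      using \<psi> \<phi>(2) subset_cstar_generated[of S] by (auto simp: S_map_def)
    then have "\<psi> a - a \<in> expanse S"
      using mem_expanse[OF S_map_ident a] mem_expanse[of \<psi> a] a
      by (intro complex_vector.subspace_diff[OF expanse])
    moreover have "\<theta> (\<psi> a - a) = 0"
      using minimal_S_projection_absorbs[OF assms \<open>S_map S \<psi>\<close> a] by (simp add: lin)
    ultimately show "x \<in> expanse S \<inter> {T. \<theta> T = 0}" using \<psi>(2)[OF a] by (simp add: x)
  qed
  moreover have "csubspace (expanse S \<inter> {T. \<theta> T = 0})"
    by (intro complex_vector.subspace_inter expanse)
      (simp add: complex_vector.subspace_def lin)
  ultimately have "cspan (abnormalities S) \<subseteq> expanse S \<inter> {T. \<theta> T = 0}"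
    by (rule complex_vector.span_minimal)
  then show "x \<in> expanse S \<inter> {T. \<theta> T = 0}" if "x \<in> cspan (abnormalities S)" for x
    using that by blast

  fix x assume x: "x \<in> expanse S \<inter> {T. \<theta> T = 0}"
  have abnormal: "\<phi> a - a \<in> cspan (abnormalities S)" if "S_map S \<phi>" "a \<in> cstar_generated S" for \<phi> a
    using that restrict[OF that(1)]
    by (intro complex_vector.span_base) (auto simp: abnormalities_def S_map_def)
  have A: "csubspace (cstar_generated S)"
    using cstar_subalgebra_generated[of S] by (simp add: cstar_subalgebra_def)
  \<comment> \<open>Modulo abnormalities every element of the expanse lies in the algebra.\<close>
  define E where "E = {x. \<exists>a\<in>cstar_generated S. x - a \<in> cspan (abnormalities S)}"
  have "csubspace E"
    unfolding complex_vector.subspace_def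
  proof (intro conjI ballI allI)
    show "0 \<in> E"
      using complex_vector.subspace_0[OF A] complex_vector.span_zero by (force simp: E_def)
    show "y + z \<in> E" if "y \<in> E" "z \<in> E" for y z
    proof -
      from that obtain a b where "a \<in> cstar_generated S" "b \<in> cstar_generated S"
        "y - a \<in> cspan (abnormalities S)" "z - b \<in> cspan (abnormalities S)"
        by (auto simp: E_def)
      then have "a + b \<in> cstar_generated S" "(y + z) - (a + b) \<in> cspan (abnormalities S)"
        using complex_vector.subspace_add[OF A] complex_vector.span_add[of "y - a" _ "z - b"]
        by (simp_all add: algebra_simps)
      then show ?thesis unfolding E_def by blast
    qed
    show "c *\<^sub>C y \<in> E" if "y \<in> E" for c y
    proof -
      from that obtain a where "a \<in> cstar_generated S" "y - a \<in> cspan (abnormalities S)"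
        by (auto simp: E_def)
      then have "c *\<^sub>C a \<in> cstar_generated S" "c *\<^sub>C y - c *\<^sub>C a \<in> cspan (abnormalities S)"
        using complex_vector.subspace_scale[OF A] complex_vector.span_scale[of "y - a" _ c]
        by (simp_all add: complex_vector.scale_right_diff_distrib)
      then show ?thesis unfolding E_def by blast
    qed
  qed
  moreover have "(\<Union>\<phi>\<in>{\<phi>. S_map S \<phi>}. \<phi> ` cstar_generated S) \<subseteq> E"
    using abnormal by (auto simp: E_def)
  ultimately have "expanse S \<subseteq> E"
    unfolding expanse_def by (intro complex_vector.span_minimal)
  then obtain a where a: "a \<in> cstar_generated S" and xa: "x - a \<in> cspan (abnormalities S)"
    using x by (auto simp: E_def)
  have "\<theta> (x - a) = 0"
    using xa \<open>cspan (abnormalities S) \<subseteq> _\<close> by blast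
  with x have "\<theta> a = 0" by (simp add: lin)
  with abnormal[OF S_map a] have "- a \<in> cspan (abnormalities S)" by simp
  then have "(x - a) - (- a) \<in> cspan (abnormalities S)"
    by (intro complex_vector.span_diff xa)
  then show "x \<in> cspan (abnormalities S)" by simp
qed

end
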